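(* Let $p\ge 2$ and let $\mathcal{B}\subset\Sigma_{2\times 2}(p)$. Suppose that (i) $\mathcal{B}$ is locally crisscross-extendable, and (ii) $\mathcal{B}$ satisfies (at least) three of the four locally corner-extendable conditions $C(1),C(2),C(3),C(4)$. Then the following are equivalent: (a) the transition matrices $\mathbb{H}_n(\mathcal{B})$ and $\mathbb{V}_n(\mathcal{B})$ are weakly primitive for all $n\geq 2$; (b) $\Sigma(\mathcal{B})$ is topologically mixing.
   Context: Lattices and patterns. $\mathcal{S}_p=\{0,1,\dots,p-1\}$ is the set of $p$ colors. For $m,n\ge1$ and $(i,j)\in\mathbb{Z}^2$, $\mathbb{Z}_{m\times n}((i,j))=\{(i+n_1,j+n_2): 0\le n_1\le m-1,\ 0\le n_2\le n-1\}$ and $\mathbb{Z}_{m\times n}=\mathbb{Z}_{m\times n}((0,0))$. $\Sigma_{m\times n}(p)=\mathcal{S}_p^{\mathbb{Z}_{m\times n}}$. Given $\mathcal{B}\subset\Sigma_{2\times2}(p)$ and $R\subset\mathbb{Z}^2$, a pattern $U\in\mathcal{S}_p^R$ is $\mathcal{B}$-admissible if $U|_{\mathbb{Z}_{2\times2}((i,j))}\in\mathcal{B}$ (after translation) whenever $\mathbb{Z}_{2\times2}((i,j))\subset R$; $\Sigma_R(\mathcal{B})$ is the set of these, $\Sigma_{m\times n}(\mathcal{B})=\Sigma_{\mathbb{Z}_{m\times n}}(\mathcal{B})$, and $\Sigma(\mathcal{B})=\Sigma_{\mathbb{Z}^2}(\mathcal{B})$. Counting function: $\psi(u_1,\dots,u_n)=1+\sum_{k=1}^n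 u_kp^{n-k}$ for $u_k\in\mathcal{S}_p$. Transition matrices. For $n\ge2$, $\mathbb{H}_n=\mathbb{H}_n(\mathcal{B})$ is the $p^n\times p^n$ zero-one matrix whose $(i,j)$ entry is $1$ iff the pattern $(u_{s,t})_{0\le s\le1,\,0\le t\le n-1}$ on $\mathbb{Z}_{2\times n}$ with $i=\psi(u_{0,0},\dots,u_{0,n-1})$ (left column) and $j=\psi(u_{1,0},\dots,u_{1,n-1})$ (right column) is $\mathcal{B}$-admissible. $\mathbb{V}_n=\mathbb{V}_n(\mathcal{B})$ is the $p^n\times p^n$ zero-one matrix whose $(i,j)$ entry is $1$ iff the pattern $(u_{s,t})_{0\le s\le n-1,\,0\le t\le1}$ on $\mathbb{Z}_{n\times2}$ with $i=\psi(u_{0,0},\dots,u_{n-1,0})$ (bottom row) and $j=\psi(u_{0,1},\dots,u_{n-1,1})$ (top row) is $\mathcal{B}$-admissible. Weak primitivity. A non-negative square matrix $A$ is weakly $N$-primitive ($N\ge1$) if for all $n\ge N$ and all $i,j$ such that the $i$-th row of $A$ is nonzero and the $j$-th column of $A$ is nonzero, $(A^n)_{i,j}>0$. $A$ is weakly primitive if it is weakly $N$-primitive for some $N\ge1$. Corner-extendability. Let $\mathbb{L}_1=\mathbb{Z}_{3\times3}\setminus\{(2,2)\}$, $\mathbb{L}_2=\mathbb{Z}_{3\times3}\setminus\{(0,2)\}$, $\mathbb{L}_3=\mathbb{Z}_{3\times3}\setminus\{(0,0)\}$, $\mathbb{L}_4=\mathbb{Z}_{3\times3}\setminus\{(2,0)\}$.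 $\mathcal{B}$ satisfies the locally corner-extendable condition $C(i)$ if for every $U\in\Sigma_{\mathbb{L}_i}(\mathcal{B})$ there is $U'\in\Sigma_{3\times3}(\mathcal{B})$ with $U'|_{\mathbb{L}_i}=U$. Crisscross-extendability. Let $\mathbb{Z}_c=\bigcup_{0\le|i|+|j|\le1}\mathbb{Z}_{2\times2}((i,j))$. $\mathcal{B}$ is locally crisscross-extendable if for every $B\in\mathcal{B}$ there is $U_c\in\Sigma_{\mathbb{Z}_c}(\mathcal{B})$ with $U_c|_{\mathbb{Z}_{2\times2}}=B$. Topological mixing. For $\Sigma\subset\mathcal{S}_p^{\mathbb{Z}^2}$ and $R\subset\mathbb{Z}^2$, $\Pi_R$ denotes restriction to $R$ and $\Pi_R(\Sigma)$ its image on $\Sigma$; $d$ is Euclidean distance. $\Sigma$ is topologically mixing if for any finite $R_1,R_2\subset\mathbb{Z}^2$ there is a constant $M=M(R_1,R_2)$ such that for all $\mathbf{v}\in\mathbb{Z}^2$ with $d(R_1,R_2+\mathbf{v})\ge M$ and all $U_1\in\Pi_{R_1}(\Sigma)$, $U_2\in\Pi_{R_2+\mathbf{v}}(\Sigma)$, there is $W\in\Sigma$ with $\Pi_{R_1}(W)=U_1$ and $\Pi_{R_2+\mathbf{v}}(W)=U_2$. *)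

theory Defs
  imports
    "HOL-Analysis.Product_Vector"
    "HOL-Analysis.Elementary_Metric_Spaces"
    "HOL-Library.FuncSet"
    "Jordan_Normal_Form.Matrix"
begin

text \<open>
  Colours are the naturals below p. A pattern on a set R of lattice sites is an element of
  the extensional function space \<open>R \<rightarrow>\<^sub>E {..<p}\<close>, so two patterns are equal iff they agree on R,
  and restricting a pattern is \<^const>\<open>restrict\<close>. Addition of sites is componentwise.
\<close>

type_synonym site = "int \<times> int"

type_synonym pattern = "site \<Rightarrow> nat"

definition lattice_at :: "nat \<Rightarrow> nat \<Rightarrow> site \<Rightarrow> site set" where
  "lattice_at m n v = {v + (int n1, int n2) | n1 n2. n1 < m \<and> n2 < n}"

definition lattice_rect :: "nat \<Rightarrow> nat \<Rightarrow> site set" where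
  "lattice_rect m n = lattice_at m n (0, 0)"

definition all_patterns :: "nat \<Rightarrow> site set \<Rightarrow> pattern set" where
  "all_patterns p R = (R \<rightarrow>\<^sub>E {..<p})"

definition admissible :: "pattern set \<Rightarrow> site set \<Rightarrow> pattern \<Rightarrow> bool" where
  "admissible B R U \<longleftrightarrow>
     (\<forall>v. lattice_at 2 2 v \<subseteq> R \<longrightarrow> restrict (\<lambda>x. U (v + x)) (lattice_rect 2 2) \<in> B)"

definition admissible_patterns :: "nat \<Rightarrow> pattern set \<Rightarrow> site set \<Rightarrow> pattern set" where
  "admissible_patterns p B R = {U \<in> all_patterns p R. admissible B R U}"

text \<open>The word \<open>u\<^sub>1 \<dots> u\<^sub>n\<close> is passed as the function \<open>u\<close> on \<open>{1..n}\<close>; the values are \<open>1, \<dots>, p ^ n\<close>.\<close>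

definition psi :: "nat \<Rightarrow> nat \<Rightarrow> (nat \<Rightarrow> nat) \<Rightarrow> nat" where
  "psi p n u = 1 + (\<Sum>k = 1..n. u k * p ^ (n - k))"

text \<open>
  Matrix indices of the library start at 0, whereas \<^const>\<open>psi\<close> counts from 1; hence the \<^const>\<open>Suc\<close>.
  For given i, j exactly one pattern U on the lattice satisfies the two equations, so the matrix
  entry is 1 iff that pattern is admissible.
\<close>

definition H_matrix :: "nat \<Rightarrow> pattern set \<Rightarrow> nat \<Rightarrow> real mat" where
  "H_matrix p B n = mat (p ^ n) (p ^ n) (\<lambda>(i, j).
     if \<exists>U \<in> admissible_patterns p B (lattice_rect 2 n).
          Suc i = psi p n (\<lambda>k. U (0, int k - 1)) \<and>
          Suc j = psi p n (\<lambda>k. U (1, int k - 1))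
     then 1 else 0)"

definition V_matrix :: "nat \<Rightarrow> pattern set \<Rightarrow> nat \<Rightarrow> real mat" where
  "V_matrix p B n = mat (p ^ n) (p ^ n) (\<lambda>(i, j).
     if \<exists>U \<in> admissible_patterns p B (lattice_rect n 2).
          Suc i = psi p n (\<lambda>k. U (int k - 1, 0)) \<and>
          Suc j = psi p n (\<lambda>k. U (int k - 1, 1))
     then 1 else 0)"

definition nonneg_square_mat :: "real mat \<Rightarrow> bool" where
  "nonneg_square_mat A \<longleftrightarrow>
     square_mat A \<and> (\<forall>i < dim_row A. \<forall>j < dim_col A. 0 \<le> A $$ (i, j))"

definition weakly_N_primitive :: "nat \<Rightarrow> real mat \<Rightarrow> bool" where
  "weakly_N_primitive N A \<longleftrightarrow>
     nonneg_square_mat A \<and>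
     (\<forall>n \<ge> N. \<forall>i < dim_row A. \<forall>j < dim_col A.
        row A i \<noteq> 0\<^sub>v (dim_col A) \<and> col A j \<noteq> 0\<^sub>v (dim_row A) \<longrightarrow> (A ^\<^sub>m n) $$ (i, j) > 0)"

definition weakly_primitive :: "real mat \<Rightarrow> bool" where
  "weakly_primitive A \<longleftrightarrow> (\<exists>N \<ge> 1. weakly_N_primitive N A)"

definition L_lattice :: "nat \<Rightarrow> site set" where
  "L_lattice i = lattice_rect 3 3 - {[(2, 2), (0, 2), (0, 0), (2, 0)] ! (i - 1)}"

definition locally_corner_extendable :: "nat \<Rightarrow> pattern set \<Rightarrow> nat \<Rightarrow> bool" where
  "locally_corner_extendable p B i \<longleftrightarrow>
     (\<forall>U \<in> admissible_patterns p B (L_lattice i).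
        \<exists>U' \<in> admissible_patterns p B (lattice_rect 3 3). restrict U' (L_lattice i) = U)"

definition crisscross_lattice :: "site set" where
  "crisscross_lattice = (\<Union>(i, j) \<in> {(i, j). \<bar>i\<bar> + \<bar>j\<bar> \<le> 1}. lattice_at 2 2 (i, j))"

definition locally_crisscross_extendable :: "nat \<Rightarrow> pattern set \<Rightarrow> bool" where
  "locally_crisscross_extendable p B \<longleftrightarrow>
     (\<forall>b \<in> B. \<exists>U \<in> admissible_patterns p B crisscross_lattice. restrict U (lattice_rect 2 2) = b)"

definition projection :: "site set \<Rightarrow> pattern set \<Rightarrow> pattern set" where
  "projection R \<Sigma> = (\<lambda>W. restrict W R) ` \<Sigma>"

definition euclid_setdist :: "site set \<Rightarrow> site set \<Rightarrow> real" where
  "euclid_setdist R S = setdist (map_prod real_of_int real_of_int ` R) (map_prod real_of_int real_of_int ` S)"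

text \<open>
  \<^const>\<open>setdist\<close> is 0 if one of the sets is empty. This convention is immaterial here: a pattern on
  one set alone always comes from some W, which then also restricts to the empty pattern.
\<close>

definition topologically_mixing :: "pattern set \<Rightarrow> bool" where
  "topologically_mixing \<Sigma> \<longleftrightarrow>
     (\<forall>R1 R2. finite R1 \<and> finite R2 \<longrightarrow>
        (\<exists>M :: real. \<forall>v. euclid_setdist R1 ((+) v ` R2) \<ge> M \<longrightarrow>
           (\<forall>U1 \<in> projection R1 \<Sigma>. \<forall>U2 \<in> projection ((+) v ` R2) \<Sigma>.
              \<exists>W \<in> \<Sigma>. restrict W R1 = U1 \<and> restrict W ((+) v ` R2) = U2)))"

end

theory Submission
  imports Defs
begin

text \<open>
  Crisscross-extendability lets a row or column be started next to a finished rectangle, and a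
  corner condition completes it site by site; opposite sides need different corners, and three of
  the four serve all sides, so every admissible rectangle extends to the plane. Hence weak
  primitivity of the transition matrices means that two square windows of plane patterns, displaced
  far enough along a coordinate axis, can always be realised in a common plane pattern; mixing
  asks for the same with an arbitrary far displacement \<open>(a, b)\<close>. If one coordinate is small, enlarge
  the windows so that the displacement becomes axis-parallel. If both are large, join the two windows
  through a third one at \<open>(a, 0)\<close>, first horizontally and then vertically, and fill in the inner
  corner of the resulting L-shaped pattern with a corner condition. That path or its mirror image,
  through \<open>(0, b)\<close>, can be filled in, as at most one corner condition fails.
\<close>

section \<open>Tile predicates and their symmetries\<close>

text \<open>The transition matrices only control strips: for each height \<open>n\<close> they give
  a threshold of their own, and only for windows in a common row or column. A small offset across
  the axis therefore has to be absorbed by larger windows, whose threshold may be larger. There is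
  no circle in this: the thresholds for side \<open>n\<close> determine how much offset must be
  absorbed, and only then are those for the enlarged side chosen.

  All six pairs of corners matter. To grow a rectangle on one side, one of the two corners at that
  side suffices, since the new line can be completed in either direction; to join windows
  diagonally, one of two opposite corners suffices.

  Extension to the plane also serves the implication from mixing to weak primitivity. A nonzero row
  or column of a matrix only provides two adjacent words of finite length, and mixing says nothing
  about them until they are known to occur in a plane pattern.\<close>

text \<open>The arguments of a tile predicate are the colours at (0,0), (1,0), (0,1), (1,1), in this order.\<close>

type_synonym tiles = "nat \<Rightarrow> nat \<Rightarrow> nat \<Rightarrow> nat \<Rightarrow> bool"

definition block_ok :: "tiles \<Rightarrow> (int \<Rightarrow> int \<Rightarrow> nat) \<Rightarrow> int \<Rightarrow> int \<Rightarrow> bool" where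
  "block_ok T W x y \<longleftrightarrow> T (W x y) (W (x + 1) y) (W x (y + 1)) (W (x + 1) (y + 1))"

text \<open>The half-open ranges run over the lower left sites of the blocks, so the sites that
  matter form the closed rectangle from \<open>(x0, y0)\<close> to \<open>(x1, y1)\<close>.
  Configurations are total functions; their values outside this rectangle are arbitrary.\<close>

definition rect_ok :: "tiles \<Rightarrow> (int \<Rightarrow> int \<Rightarrow> nat) \<Rightarrow> int \<Rightarrow> int \<Rightarrow> int \<Rightarrow> int \<Rightarrow> bool" where
  "rect_ok T W x0 x1 y0 y1 \<longleftrightarrow> (\<forall>x\<in>{x0..<x1}. \<forall>y\<in>{y0..<y1}. block_ok T W x y)"

definition tiling :: "tiles \<Rightarrow> (int \<Rightarrow> int \<Rightarrow> nat) \<Rightarrow> bool" where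
  "tiling T W \<longleftrightarrow> (\<forall>x y. block_ok T W x y)"

text \<open>The colours of a 3 by 3 square are named a b c, d e f, g h i, from the bottom row to the top row.\<close>

definition corner_ur :: "tiles \<Rightarrow> bool" where
  "corner_ur T \<longleftrightarrow> (\<forall>a b c d e f g h. T a b d e \<longrightarrow> T b c e f \<longrightarrow> T d e g h \<longrightarrow> (\<exists>i. T e f h i))"

definition corner_ul :: "tiles \<Rightarrow> bool" where
  "corner_ul T \<longleftrightarrow> (\<forall>a b c d e f h i. T a b d e \<longrightarrow> T b c e f \<longrightarrow> T e f h i \<longrightarrow> (\<exists>g. T d e g h))"

definition corner_ll :: "tiles \<Rightarrow> bool" where
  "corner_ll T \<longleftrightarrow> (\<forall>b c d e f g h i. T b c e f \<longrightarrow> T d e g h \<longrightarrow> T e f h i \<longrightarrow> (\<exists>a. T a b d e))"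

definition corner_lr :: "tiles \<Rightarrow> bool" where
  "corner_lr T \<longleftrightarrow> (\<forall>a b d e f g h i. T a b d e \<longrightarrow> T d e g h \<longrightarrow> T e f h i \<longrightarrow> (\<exists>c. T b c e f))"

text \<open>The four outer blocks of a crisscross overlap at most in sites of the central block, so
  each side gets an existential of its own: right, left, above, below.\<close>

definition extendable :: "tiles \<Rightarrow> bool" where
  "extendable T \<longleftrightarrow> (\<forall>a b c d. T a b c d \<longrightarrow>
     (\<exists>e f. T b e d f) \<and> (\<exists>e f. T e a f c) \<and> (\<exists>e f. T c d e f) \<and> (\<exists>e f. T e f a b))"

text \<open>The corner conditions enter as six disjunctions because each case distinction asks for
  one particular pair: adjacent corners for growing a side, opposite corners for filling an
  L-shape.\<close>

definition fillable :: "tiles \<Rightarrow> bool" where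
  "fillable T \<longleftrightarrow> extendable T \<and>
     (corner_ur T \<or> corner_ul T) \<and> (corner_ur T \<or> corner_ll T) \<and> (corner_ur T \<or> corner_lr T) \<and>
     (corner_ul T \<or> corner_ll T) \<and> (corner_ul T \<or> corner_lr T) \<and> (corner_ll T \<or> corner_lr T)"

text \<open>This left-right reflection and the diagonal reflection \<open>swap_axes\<close> generate
  all symmetries of the square, so each construction is carried out in one orientation and
  transported to the others.\<close>

definition mirror :: "tiles \<Rightarrow> tiles" where
  "mirror T = (\<lambda>a b c d. T b a d c)"

definition swap_axes :: "tiles \<Rightarrow> tiles" where
  "swap_axes T = (\<lambda>a b c d. T a c b d)"

lemma mirror_mirror [simp]: "mirror (mirror T) = T"
  by (simp add: mirror_def)

lemma swap_axes_swap_axes [simp]: "swap_axes (swap_axes T) = T"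
  by (simp add: swap_axes_def)

lemma corner_mirror:
  "corner_ur (mirror T) \<longleftrightarrow> corner_ul T" "corner_ul (mirror T) \<longleftrightarrow> corner_ur T"
  "corner_ll (mirror T) \<longleftrightarrow> corner_lr T" "corner_lr (mirror T) \<longleftrightarrow> corner_ll T"
proof -
  have "corner_ul (mirror T)" if "corner_ur T" for T
    unfolding corner_ul_def mirror_def using that[unfolded corner_ur_def] by meson
  moreover have "corner_ur (mirror T)" if "corner_ul T" for T
    unfolding corner_ur_def mirror_def using that[unfolded corner_ul_def] by meson
  moreover have "corner_lr (mirror T)" if "corner_ll T" for T
    unfolding corner_lr_def mirror_def using that[unfolded corner_ll_def] by meson
  moreover have "corner_ll (mirror T)" if "corner_lr T" for T
    unfolding corner_ll_def mirror_def using that[unfolded corner_lr_def] by meson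
  \<comment> \<open>Each implication holds for all \<open>T\<close>; applied to
    \<open>mirror T\<close> it yields the converse, as \<open>mirror\<close> is an
    involution.\<close>
  ultimately show "corner_ur (mirror T) \<longleftrightarrow> corner_ul T" "corner_ul (mirror T) \<longleftrightarrow> corner_ur T"
    "corner_ll (mirror T) \<longleftrightarrow> corner_lr T" "corner_lr (mirror T) \<longleftrightarrow> corner_ll T"
    by (metis mirror_mirror)+
qed

lemma corner_swap:
  "corner_ur (swap_axes T) \<longleftrightarrow> corner_ur T" "corner_ul (swap_axes T) \<longleftrightarrow> corner_lr T"
  "corner_ll (swap_axes T) \<longleftrightarrow> corner_ll T" "corner_lr (swap_axes T) \<longleftrightarrow> corner_ul T"
proof -
  have "corner_ur (swap_axes T)" if "corner_ur T" for T
    unfolding corner_ur_def swap_axes_def using that[unfolded corner_ur_def] by meson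
  moreover have "corner_ul (swap_axes T)" if "corner_lr T" for T
    unfolding corner_ul_def swap_axes_def using that[unfolded corner_lr_def] by meson
  moreover have "corner_ll (swap_axes T)" if "corner_ll T" for T
    unfolding corner_ll_def swap_axes_def using that[unfolded corner_ll_def] by meson
  moreover have "corner_lr (swap_axes T)" if "corner_ul T" for T
    unfolding corner_lr_def swap_axes_def using that[unfolded corner_ul_def] by meson
  ultimately show "corner_ur (swap_axes T) \<longleftrightarrow> corner_ur T"
    "corner_ul (swap_axes T) \<longleftrightarrow> corner_lr T"
    "corner_ll (swap_axes T) \<longleftrightarrow> corner_ll T" "corner_lr (swap_axes T) \<longleftrightarrow> corner_ul T"
    by (metis swap_axes_swap_axes)+
qed

lemma extendable_mirror: "extendable T \<Longrightarrow> extendable (mirror T)"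
  unfolding extendable_def mirror_def by metis

lemma extendable_swap: "extendable T \<Longrightarrow> extendable (swap_axes T)"
  unfolding extendable_def swap_axes_def by metis

lemma fillable_mirror: "fillable T \<Longrightarrow> fillable (mirror T)"
  unfolding fillable_def corner_mirror using extendable_mirror by blast

lemma fillable_swap: "fillable T \<Longrightarrow> fillable (swap_axes T)"
  unfolding fillable_def corner_swap using extendable_swap by blast

text \<open>A block is addressed by its lower left site, which the reflection obtains from the lower
  right one; hence the extra \<open>- 1\<close>.\<close>

lemma block_ok_mirror:
  "block_ok (mirror T) (\<lambda>x y. W (c - x) y) x y = block_ok T W (c - x - 1) y"
  by (simp add: block_ok_def mirror_def algebra_simps)

lemma block_ok_swap:
  "block_ok (swap_axes T) (\<lambda>x y. W y x) x y = block_ok T W y x"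
  by (simp add: block_ok_def swap_axes_def)

lemma rect_ok_mirror:
  assumes "rect_ok T W x0 x1 y0 y1"
  shows "rect_ok (mirror T) (\<lambda>x y. W (- x) y) (- x1) (- x0) y0 y1"
  using assms block_ok_mirror[of T W 0] by (simp add: rect_ok_def)

lemma rect_ok_swap:
  "rect_ok (swap_axes T) (\<lambda>x y. W y x) y0 y1 x0 x1 \<longleftrightarrow> rect_ok T W x0 x1 y0 y1"
  unfolding rect_ok_def block_ok_swap by blast

lemma tiling_mirror: "tiling T W \<Longrightarrow> tiling (mirror T) (\<lambda>x y. W (c - x) y)"
  by (simp add: tiling_def block_ok_mirror)

lemma tiling_swap: "tiling T W \<Longrightarrow> tiling (swap_axes T) (\<lambda>x y. W y x)"
  by (simp add: tiling_def block_ok_swap)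

lemma tiling_shift: "tiling T W \<Longrightarrow> tiling T (\<lambda>x y. W (x + a) (y + b))"
proof -
  assume "tiling T W"
  then have "block_ok T W (x + a) (y + b)" for x y by (simp add: tiling_def)
  then show ?thesis by (simp add: tiling_def block_ok_def algebra_simps)
qed

lemma tiling_rect_ok: "tiling T W \<Longrightarrow> rect_ok T W x0 x1 y0 y1"
  by (simp add: tiling_def rect_ok_def)

lemma rect_ok_add_row:
  assumes "rect_ok T W x0 x1 y0 y" "\<And>x. x0 \<le> x \<Longrightarrow> x < x1 \<Longrightarrow> block_ok T W x y"
  shows "rect_ok T W x0 x1 y0 (y + 1)"
  unfolding rect_ok_def
proof (intro ballI)
  fix u v assume "u \<in> {x0..<x1}" "v \<in> {y0..<y + 1}"
  then show "block_ok T W u v" using assms by (cases "v = y") (auto simp: rect_ok_def)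
qed

section \<open>Completing and extending rectangles\<close>

text \<open>The new row is completed from right to left, one site at a time. Each new site is the
  upper left corner of a 3 by 3 square whose other three blocks are present: two in the row of
  blocks below, which exists by \<open>y0 < y\<close>, and one just completed, or given at the start
  by \<open>xm < x1\<close>.\<close>

lemma row_completion:
  assumes "corner_ul T" "y0 < y" "rect_ok T W x0 x1 y0 y"
    and "xm < x1" "\<forall>x\<in>{xm..<x1}. block_ok T W x y"
  shows "\<exists>W'. rect_ok T W' x0 x1 y0 (y + 1) \<and>
    (\<forall>u v. v \<noteq> y + 1 \<or> xm \<le> u \<longrightarrow> W' u v = W u v)"
  using assms(3-5)
proof (induction "nat (xm - x0)" arbitrary: xm W)
  case 0
  then have "rect_ok T W x0 x1 y0 (y + 1)"
    by (intro rect_ok_add_row) auto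
  then show ?case by blast
next
  case (Suc k)
  define z where "z = xm - 1"
  have z: "x0 \<le> z" "z + 1 < x1" using Suc.hyps(2) Suc.prems by (auto simp: z_def)
  have "block_ok T W z (y - 1)" "block_ok T W (z + 1) (y - 1)" "block_ok T W (z + 1) y"
    using Suc.prems z assms(2) by (auto simp: rect_ok_def z_def)
  then obtain g where g: "T (W z y) (W (z + 1) y) g (W (z + 1) (y + 1))"
    using assms(1) unfolding corner_ul_def block_ok_def by (fastforce simp: add.commute)
  define V where "V = (\<lambda>u v. if u = z \<and> v = y + 1 then g else W u v)"
  have "rect_ok T V x0 x1 y0 y"
    using Suc.prems(1) by (auto simp: rect_ok_def block_ok_def V_def)
  moreover have "\<forall>x\<in>{z..<x1}. block_ok T V x y"
  proof
    fix x assume "x \<in> {z..<x1}"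
    then consider "x = z" | "x \<in> {xm..<x1}" "x > z" unfolding z_def by fastforce
    then show "block_ok T V x y"
      using g Suc.prems(3) by cases (auto simp: block_ok_def V_def)
  qed
  moreover have "k = nat (z - x0)" "z < x1" using Suc.hyps(2) z by (auto simp: z_def)
  ultimately obtain W' where "rect_ok T W' x0 x1 y0 (y + 1)"
    and W': "\<forall>u v. v \<noteq> y + 1 \<or> z \<le> u \<longrightarrow> W' u v = V u v"
    using Suc.hyps(1)[of z V] by blast
  moreover have "\<forall>u v. v \<noteq> y + 1 \<or> xm \<le> u \<longrightarrow> W' u v = W u v"
    using W' by (auto simp: V_def z_def)
  ultimately show ?case by blast
qed

text \<open>The data form an L: a horizontal bar up to height \<open>ym\<close> and a vertical bar
  from column \<open>xm\<close> on. The missing rows at the upper left are completed upwards; the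
  vertical bar supplies the blocks from which each row starts, and the strict inequalities make both
  bars at least one block thick.\<close>

lemma rectangle_completion:
  assumes "corner_ul T" "y0 < ym" "xm < x1" "ym \<le> y1"
    and "rect_ok T W x0 x1 y0 ym" "rect_ok T W xm x1 y0 y1"
  shows "\<exists>W'. rect_ok T W' x0 x1 y0 y1 \<and> (\<forall>u v. v \<le> ym \<or> xm \<le> u \<longrightarrow> W' u v = W u v)"
  using assms(4,6)
proof (induction y1 rule: int_ge_induct)
  case base
  then show ?case using assms(5) by blast
next
  case (step y)
  have "rect_ok T W xm x1 y0 y" using step.prems by (auto simp: rect_ok_def)
  then obtain V where V: "rect_ok T V x0 x1 y0 y" "\<forall>u v. v \<le> ym \<or> xm \<le> u \<longrightarrow> V u v = W u v"
    using step.IH by blast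
  have "\<forall>x\<in>{xm..<x1}. block_ok T V x y"
    using step.prems V(2) step.hyps assms(2) by (auto simp: rect_ok_def block_ok_def)
  then obtain W' where "rect_ok T W' x0 x1 y0 (y + 1)"
    and "\<forall>u v. v \<noteq> y + 1 \<or> xm \<le> u \<longrightarrow> W' u v = V u v"
    using row_completion[OF assms(1) _ V(1) assms(3)] assms(2) step.hyps by (meson less_le_trans)
  then show ?case using V(2) step.hyps by (intro exI[of _ W']) auto
qed

text \<open>Extending all blocks of the top row independently would not give matching blocks. So
  extendability is used only above the upper right block, and the corner condition continues the new
  row to the left.\<close>

lemma extend_up_aux:
  assumes "extendable T" "corner_ul T" "x0 < x1" "y0 < y1" "rect_ok T W x0 x1 y0 y1"
  shows "\<exists>W'. rect_ok T W' x0 x1 y0 (y1 + 1) \<and> (\<forall>u v. v \<le> y1 \<longrightarrow> W' u v = W u v)"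
proof -
  have "block_ok T W (x1 - 1) (y1 - 1)" using assms by (auto simp: rect_ok_def)
  then obtain e f where ef: "T (W (x1 - 1) y1) (W x1 y1) e f"
    using assms(1) unfolding block_ok_def extendable_def by (metis diff_add_cancel)
  \<comment> \<open>Only the colours at \<open>x1 - 1\<close> and \<open>x1\<close> count in the new
    row; further left \<open>e\<close> is a filler that \<open>row_completion\<close> is free to
    overwrite.\<close>
  define V where "V = (\<lambda>u v. if v = y1 + 1 then if u = x1 then f else e else W u v)"
  have "rect_ok T V x0 x1 y0 y1"
    using assms(5) by (auto simp: rect_ok_def block_ok_def V_def)
  moreover have "\<forall>x\<in>{x1 - 1..<x1}. block_ok T V x y1"
  proof
    fix x assume "x \<in> {x1 - 1..<x1}"
    then have "x = x1 - 1" by simp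
    then show "block_ok T V x y1" using ef by (simp add: block_ok_def V_def)
  qed
  ultimately obtain W' where "rect_ok T W' x0 x1 y0 (y1 + 1)"
    and "\<forall>u v. v \<noteq> y1 + 1 \<or> x1 - 1 \<le> u \<longrightarrow> W' u v = V u v"
    using row_completion[OF assms(2,4), of V x0 x1 "x1 - 1"] by auto
  then show ?thesis by (intro exI[of _ W']) (auto simp: V_def)
qed

lemma extend_up:
  assumes "fillable T" "x0 < x1" "y0 < y1" "rect_ok T W x0 x1 y0 y1"
  shows "\<exists>W'. rect_ok T W' x0 x1 y0 (y1 + 1) \<and> (\<forall>u v. v \<le> y1 \<longrightarrow> W' u v = W u v)"
proof (cases "corner_ul T")
  case True
  then show ?thesis using assms extend_up_aux by (simp add: fillable_def)
next
  case False
  \<comment> \<open>In the mirrored plane the row is completed from left to right, which uses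
    \<open>corner_ur T\<close> instead.\<close>
  then have "corner_ul (mirror T)" "extendable (mirror T)"
    using assms(1) fillable_mirror[OF assms(1)] by (auto simp: corner_mirror fillable_def)
  then obtain V where V: "rect_ok (mirror T) V (- x1) (- x0) y0 (y1 + 1)"
    "\<forall>u v. v \<le> y1 \<longrightarrow> V u v = W (- u) v"
    using extend_up_aux[of "mirror T" "- x1" "- x0" y0 y1 "\<lambda>x y. W (- x) y"] assms
      rect_ok_mirror[OF assms(4)] by auto
  then show ?thesis
    using rect_ok_mirror[OF V(1)] by (intro exI[of _ "\<lambda>x y. V (- x) y"]) simp
qed

lemma extend_right:
  assumes "fillable T" "x0 < x1" "y0 < y1" "rect_ok T W x0 x1 y0 y1"
  shows "\<exists>W'. rect_ok T W' x0 (x1 + 1) y0 y1 \<and> (\<forall>u v. u \<le> x1 \<longrightarrow> W' u v = W u v)"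
proof -
  obtain V where "rect_ok (swap_axes T) V y0 y1 x0 (x1 + 1)" "\<forall>u v. v \<le> x1 \<longrightarrow> V u v = W v u"
    using extend_up[OF fillable_swap[OF assms(1)] assms(3,2), of "\<lambda>x y. W y x"] assms(4)
    by (auto simp: rect_ok_swap)
  then show ?thesis
    using rect_ok_swap[of T "\<lambda>x y. V y x"] by (intro exI[of _ "\<lambda>x y. V y x"]) simp
qed

lemma extend_left:
  assumes "fillable T" "x0 < x1" "y0 < y1" "rect_ok T W x0 x1 y0 y1"
  shows "\<exists>W'. rect_ok T W' (x0 - 1) x1 y0 y1 \<and> (\<forall>u v. x0 \<le> u \<longrightarrow> W' u v = W u v)"
proof -
  obtain V where V: "rect_ok (mirror T) V (- x1) (- x0 + 1) y0 y1"
    "\<forall>u v. u \<le> - x0 \<longrightarrow> V u v = W (- u) v"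
    using extend_right[OF fillable_mirror[OF assms(1)], of "- x1" "- x0" y0 y1 "\<lambda>x y. W (- x) y"] assms
      rect_ok_mirror[OF assms(4)] by auto
  then show ?thesis
    using rect_ok_mirror[OF V(1)] by (intro exI[of _ "\<lambda>x y. V (- x) y"]) simp
qed

lemma extend_down:
  assumes "fillable T" "x0 < x1" "y0 < y1" "rect_ok T W x0 x1 y0 y1"
  shows "\<exists>W'. rect_ok T W' x0 x1 (y0 - 1) y1 \<and> (\<forall>u v. y0 \<le> v \<longrightarrow> W' u v = W u v)"
proof -
  obtain V where "rect_ok (swap_axes T) V (y0 - 1) y1 x0 x1" "\<forall>u v. y0 \<le> u \<longrightarrow> V u v = W v u"
    using extend_left[OF fillable_swap[OF assms(1)] assms(3,2), of "\<lambda>x y. W y x"] assms(4)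
    by (auto simp: rect_ok_swap)
  then show ?thesis
    using rect_ok_swap[of T "\<lambda>x y. V y x"] by (intro exI[of _ "\<lambda>x y. V y x"]) simp
qed

text \<open>Each side is added to the rectangle already enlarged by the previous ones, so the corner
  sites of the frame need no separate treatment.\<close>

lemma extend_around:
  assumes "fillable T" "x0 < x1" "y0 < y1" "rect_ok T W x0 x1 y0 y1"
  shows "\<exists>W'. rect_ok T W' (x0 - 1) (x1 + 1) (y0 - 1) (y1 + 1) \<and>
    (\<forall>u\<in>{x0..x1}. \<forall>v\<in>{y0..y1}. W' u v = W u v)"
proof -
  obtain W1 where W1: "rect_ok T W1 x0 x1 y0 (y1 + 1)" "\<forall>u v. v \<le> y1 \<longrightarrow> W1 u v = W u v"
    using extend_up[OF assms] by blast
  obtain W2 where W2: "rect_ok T W2 x0 x1 (y0 - 1) (y1 + 1)" "\<forall>u v. y0 \<le> v \<longrightarrow> W2 u v = W1 u v"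
    using extend_down[OF assms(1,2) _ W1(1)] assms(3) by force
  obtain W3 where W3: "rect_ok T W3 x0 (x1 + 1) (y0 - 1) (y1 + 1)" "\<forall>u v. u \<le> x1 \<longrightarrow> W3 u v = W2 u v"
    using extend_right[OF assms(1,2) _ W2(1)] assms(3) by force
  obtain W4 where "rect_ok T W4 (x0 - 1) (x1 + 1) (y0 - 1) (y1 + 1)" "\<forall>u v. x0 \<le> u \<longrightarrow> W4 u v = W3 u v"
    using extend_left[OF assms(1) _ _ W3(1)] assms(2,3) by force
  then show ?thesis using W1(2) W2(2) W3(2) by (intro exI[of _ W4]) auto
qed

text \<open>Frames are added one after the other, each leaving the earlier rectangle fixed. The
  colour of every site is thus eventually constant, and the pointwise limit is the tiling.\<close>

lemma rectangle_extends:
  assumes "fillable T" "x0 < x1" "y0 < y1" "rect_ok T W x0 x1 y0 y1"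
  shows "\<exists>W'. tiling T W' \<and> (\<forall>u\<in>{x0..x1}. \<forall>v\<in>{y0..y1}. W' u v = W u v)"
proof -
  define P where "P = (\<lambda>k V. rect_ok T V (x0 - int k) (x1 + int k) (y0 - int k) (y1 + int k))"
  define Q where "Q = (\<lambda>k V V'. \<forall>u\<in>{x0 - int k..x1 + int k}. \<forall>v\<in>{y0 - int k..y1 + int k}.
    V' u v = (V u v :: nat))"
  have step: "\<exists>V'. P (Suc k) V' \<and> Q k V V'" if "P k V" for k V
    using extend_around[OF assms(1) _ _ that[unfolded P_def]] assms(2,3)
    by (force simp: P_def Q_def algebra_simps)
  obtain F where F: "\<forall>k. P k (F k) \<and> Q k (F k) (F (Suc k))" "F 0 = W"
  proof -
    define F where "F = rec_nat W (\<lambda>k V. SOME V'. P (Suc k) V' \<and> Q k V V')"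
    have *: "P (Suc k) (F (Suc k)) \<and> Q k (F k) (F (Suc k))" if "P k (F k)" for k
      using someI_ex[OF step[OF that]] by (simp add: F_def)
    have "P k (F k)" for k
      by (induction k) (use assms(4) * in \<open>auto simp: F_def P_def\<close>)
    moreover have "F 0 = W" by (simp add: F_def)
    ultimately show ?thesis using * that by blast
  qed
  have stable: "F m u v = F k u v"
    if "k \<le> m" "u \<in> {x0 - int k..x1 + int k}" "v \<in> {y0 - int k..y1 + int k}" for k m u v
    using that(1)
  proof (induction m rule: dec_induct)
    case (step m)
    have "Q m (F m) (F (Suc m))" using F(1) by blast
    then show ?case using step that(2,3) by (auto simp: Q_def)
  qed simp
  \<comment> \<open>The rectangle of stage \<open>r u v\<close> contains \<open>(u, v)\<close>, so
    from this stage on the colour there no longer changes.\<close>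
  define r where "r = (\<lambda>u v. nat (\<bar>u - x0\<bar> + \<bar>v - y0\<bar>))"
  define W' where "W' = (\<lambda>u v. F (r u v) u v)"
  have W': "W' u v = F k u v" if "r u v \<le> k" for u v k
  proof -
    have "u \<in> {x0 - int (r u v)..x1 + int (r u v)}" "v \<in> {y0 - int (r u v)..y1 + int (r u v)}"
      using assms(2,3) by (auto simp: r_def)
    then show ?thesis using stable[OF that] by (simp add: W'_def)
  qed
  have "block_ok T W' x y" for x y
  proof -
    \<comment> \<open>The summand 2 bounds the growth of \<open>r\<close> from \<open>(x, y)\<close>
      to the opposite site \<open>(x + 1, y + 1)\<close> of the block.\<close>
    define k where "k = nat (\<bar>x - x0\<bar> + \<bar>y - y0\<bar> + 2)"
    have "block_ok T (F k) x y"
    proof -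
      have "x \<in> {x0 - int k..<x1 + int k}" "y \<in> {y0 - int k..<y1 + int k}"
        using assms(2,3) by (auto simp: k_def)
      then show ?thesis using F(1) unfolding P_def rect_ok_def by blast
    qed
    moreover have "W' x y = F k x y" "W' (x + 1) y = F k (x + 1) y"
      "W' x (y + 1) = F k x (y + 1)" "W' (x + 1) (y + 1) = F k (x + 1) (y + 1)"
      by (rule W'; simp add: r_def k_def)+
    ultimately show ?thesis by (simp add: block_ok_def)
  qed
  moreover have "W' u v = W u v" if "u \<in> {x0..x1}" "v \<in> {y0..y1}" for u v
    using stable[of 0 "r u v" u v] that F(2) by (simp add: W'_def)
  ultimately show ?thesis unfolding tiling_def by blast
qed

section \<open>Joining square windows\<close>

text \<open>The windows are cut out of whole tilings because mixing concerns only patterns that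
  occur in the plane. As in mixing, \<open>W2\<close> is read at the displaced window itself and not
  at the origin.\<close>

definition joinable :: "tiles \<Rightarrow> nat \<Rightarrow> int \<Rightarrow> int \<Rightarrow> bool" where
  "joinable T n a b \<longleftrightarrow> (\<forall>W1 W2. tiling T W1 \<longrightarrow> tiling T W2 \<longrightarrow>
     (\<exists>W. tiling T W \<and> (\<forall>x\<in>{0..<int n}. \<forall>y\<in>{0..<int n}.
        W x y = W1 x y \<and> W (x + a) (y + b) = W2 (x + a) (y + b))))"

lemma joinable_uminus:
  assumes "joinable T n a b"
  shows "joinable T n (- a) (- b)"
  unfolding joinable_def
proof (intro allI impI)
  fix W1 W2 assume W: "tiling T W1" "tiling T W2"
  obtain V where V: "tiling T V" "\<forall>x\<in>{0..<int n}. \<forall>y\<in>{0..<int n}.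
      V x y = W2 (x - a) (y - b) \<and> V (x + a) (y + b) = W1 x y"
    using assms[unfolded joinable_def, rule_format, OF tiling_shift[OF W(2), of "- a" "- b"]
      tiling_shift[OF W(1), of "- a" "- b"]] by auto
  then show "\<exists>W. tiling T W \<and> (\<forall>x\<in>{0..<int n}. \<forall>y\<in>{0..<int n}.
        W x y = W1 x y \<and> W (x + - a) (y + - b) = W2 (x + - a) (y + - b))"
    by (intro exI[of _ "\<lambda>x y. V (x + a) (y + b)"]) (simp add: tiling_shift)
qed

lemma joinable_swap:
  assumes "joinable T n a b"
  shows "joinable (swap_axes T) n b a"
  unfolding joinable_def
proof (intro allI impI)
  fix W1 W2 assume W: "tiling (swap_axes T) W1" "tiling (swap_axes T) W2"
  obtain V where V: "tiling T V" "\<forall>x\<in>{0..<int n}. \<forall>y\<in>{0..<int n}.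
      V x y = W1 y x \<and> V (x + a) (y + b) = W2 (y + b) (x + a)"
    using assms[unfolded joinable_def, rule_format, OF tiling_swap[OF W(1), simplified]
      tiling_swap[OF W(2), simplified]] by auto
  then show "\<exists>W. tiling (swap_axes T) W \<and> (\<forall>x\<in>{0..<int n}. \<forall>y\<in>{0..<int n}.
        W x y = W1 x y \<and> W (x + b) (y + a) = W2 (x + b) (y + a))"
    by (intro exI[of _ "\<lambda>x y. V y x"]) (simp add: tiling_swap)
qed

lemma joinable_mirror:
  assumes "joinable T n a b"
  shows "joinable (mirror T) n (- a) b"
  unfolding joinable_def
proof (intro allI impI)
  \<comment> \<open>The reflection sending \<open>x\<close> to \<open>?c - x\<close> maps the
    columns of the window at the origin onto themselves, so the only effect on the displacement is
    that \<open>a\<close> changes sign.\<close>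
  let ?c = "int n - 1"
  fix W1 W2 assume W: "tiling (mirror T) W1" "tiling (mirror T) W2"
  obtain V where V: "tiling T V" "\<forall>x\<in>{0..<int n}. \<forall>y\<in>{0..<int n}.
      V x y = W1 (?c - x) y \<and> V (x + a) (y + b) = W2 (?c - (x + a)) (y + b)"
    using assms[unfolded joinable_def, rule_format, OF tiling_mirror[OF W(1), of ?c, simplified]
      tiling_mirror[OF W(2), of ?c, simplified]] by auto
  have "V (?c - x) y = W1 x y \<and> V (?c - (x - a)) (y + b) = W2 (x - a) (y + b)"
    if "x \<in> {0..<int n}" "y \<in> {0..<int n}" for x y
    using V(2)[rule_format, of "?c - x" y] that by (simp add: algebra_simps)
  then show "\<exists>W. tiling (mirror T) W \<and> (\<forall>x\<in>{0..<int n}. \<forall>y\<in>{0..<int n}.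
        W x y = W1 x y \<and> W (x + - a) (y + b) = W2 (x + - a) (y + b))"
    using tiling_mirror[OF V(1), of ?c] by (intro exI[of _ "\<lambda>x y. V (?c - x) y"]) simp
qed

text \<open>The larger windows at the origin and at \<open>(a, 0)\<close> have \<open>k\<close>
  spare rows, enough to contain the small windows at the origin and at
  \<open>(a, b)\<close>.\<close>

lemma joinable_mono:
  assumes "joinable T (n + k) a 0" "0 \<le> b" "b \<le> int k"
  shows "joinable T n a b"
  unfolding joinable_def
proof (intro allI impI)
  fix W1 W2 assume "tiling T W1" "tiling T W2"
  then obtain W where W: "tiling T W" "\<forall>x\<in>{0..<int (n + k)}. \<forall>y\<in>{0..<int (n + k)}.
      W x y = W1 x y \<and> W (x + a) (y + 0) = W2 (x + a) (y + 0)"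
    using assms(1) unfolding joinable_def by blast
  have "W x y = W1 x y \<and> W (x + a) (y + b) = W2 (x + a) (y + b)"
    if "x \<in> {0..<int n}" "y \<in> {0..<int n}" for x y
    using W(2)[rule_format, of x y] W(2)[rule_format, of x "y + b"] that assms(2,3) by auto
  then show "\<exists>W. tiling T W \<and> (\<forall>x\<in>{0..<int n}. \<forall>y\<in>{0..<int n}.
        W x y = W1 x y \<and> W (x + a) (y + b) = W2 (x + a) (y + b))"
    using W(1) by blast
qed

lemma joinable_diagonal_ul:
  assumes "fillable T" "corner_ul T" "n \<ge> 2" "joinable T n a 0" "joinable T n 0 b"
    and "a > int n" "b > int n"
  shows "joinable T n a b"
  unfolding joinable_def
proof (intro allI impI)
  fix W1 W2 assume W: "tiling T W1" "tiling T W2"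
  let ?I = "{0..<int n}"
  \<comment> \<open>Any tiling could fill the intermediate window at \<open>(a, 0)\<close>; a
    translate of \<open>W2\<close> is at hand.\<close>
  define Wc where "Wc = (\<lambda>x y. W2 x (y + b))"
  have Wc: "tiling T Wc" using tiling_shift[OF W(2), of 0 b] by (simp add: Wc_def)
  obtain S where S: "tiling T S" "\<forall>x\<in>?I. \<forall>y\<in>?I. S x y = W1 x y \<and> S (x + a) y = Wc (x + a) y"
    using assms(4)[unfolded joinable_def, rule_format, OF W(1) Wc] by auto
  \<comment> \<open>In the coordinates of \<open>R\<close> column \<open>a\<close> becomes column 0,
    so that the vertical joining starts at the origin.\<close>
  obtain R where R: "tiling T R"
    "\<forall>x\<in>?I. \<forall>y\<in>?I. R x y = Wc (x + a) y \<and> R x (y + b) = W2 (x + a) (y + b)"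
    using assms(5)[unfolded joinable_def, rule_format,
      OF tiling_shift[OF Wc, of a 0] tiling_shift[OF W(2), of a 0]] by auto
  define V where "V = (\<lambda>x y. if y < int n then S x y else R (x - a) y)"
  have VS: "V x y = S x y" if "y < int n" for x y using that by (simp add: V_def)
  \<comment> \<open>\<open>S\<close> and the translate of \<open>R\<close> both show
    \<open>Wc\<close> on the window at \<open>(a, 0)\<close>, so the two bars of the L fit
    together.\<close>
  have VR: "V x y = R (x - a) y" if "x \<in> {a..<a + int n}" "0 \<le> y" for x y
    using that S(2)[rule_format, of "x - a" y] R(2)[rule_format, of "x - a" y] by (auto simp: V_def)
  have "rect_ok T V 0 (a + int n - 1) 0 (int n - 1)"
    using S(1) by (auto simp: rect_ok_def block_ok_def VS tiling_def)
  moreover have "rect_ok T V a (a + int n - 1) 0 (b + int n - 1)"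
  proof -
    have "block_ok T R (x - a) y" for x y using R(1) by (simp add: tiling_def)
    then show ?thesis by (auto simp: rect_ok_def block_ok_def VR algebra_simps)
  qed
  ultimately obtain V' where V': "rect_ok T V' 0 (a + int n - 1) 0 (b + int n - 1)"
    "\<forall>u v. v \<le> int n - 1 \<or> a \<le> u \<longrightarrow> V' u v = V u v"
    using rectangle_completion[OF assms(2), of 0 "int n - 1" a "a + int n - 1" "b + int n - 1" V 0]
      assms(3,6,7) by auto
  obtain W where W: "tiling T W"
    "\<forall>u\<in>{0..a + int n - 1}. \<forall>v\<in>{0..b + int n - 1}. W u v = V' u v"
    using rectangle_extends[OF assms(1) _ _ V'(1)] assms(3,6,7) by auto
  have "W x y = W1 x y \<and> W (x + a) (y + b) = W2 (x + a) (y + b)" if "x \<in> ?I" "y \<in> ?I" for x y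
    using that W(2) V'(2) VS[of y x] VR[of "x + a" "y + b"] S(2) R(2) assms(6,7) by auto
  then show "\<exists>W. tiling T W \<and> (\<forall>x\<in>?I. \<forall>y\<in>?I.
        W x y = W1 x y \<and> W (x + a) (y + b) = W2 (x + a) (y + b))"
    using W(1) by blast
qed

lemma joinable_diagonal_pos:
  assumes "fillable T" "n \<ge> 2" "joinable T n a 0" "joinable T n 0 b" "a > int n" "b > int n"
  shows "joinable T n a b"
proof (cases "corner_ul T")
  case True
  then show ?thesis using joinable_diagonal_ul assms by blast
next
  case False
  then have "corner_ul (swap_axes T)" using assms(1) by (auto simp: fillable_def corner_swap)
  then have "joinable (swap_axes T) n b a"
    using joinable_diagonal_ul[OF fillable_swap[OF assms(1)]] assms joinable_swap by metis
  then show ?thesis using joinable_swap by fastforce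
qed

lemma joinable_diagonal:
  assumes "fillable T" "n \<ge> 2" "joinable T n a 0" "joinable T n 0 b" "\<bar>a\<bar> > int n" "\<bar>b\<bar> > int n"
  shows "joinable T n a b"
proof -
  have pos: "joinable T n a b"
    if T: "fillable T" "joinable T n a 0" "joinable T n 0 b" "a > int n" "\<bar>b\<bar> > int n" for T a b
  proof (cases "b > 0")
    case True
    then show ?thesis using joinable_diagonal_pos[OF T(1) assms(2) T(2,3,4)] T(5) by simp
  next
    case False
    \<comment> \<open>Exchanging the windows negates both coordinates and mirroring restores the
      first, so only the sign of \<open>b\<close> changes.\<close>
    have "joinable (mirror T) n a 0" "joinable (mirror T) n 0 (- b)"
      using joinable_mirror[OF joinable_uminus[OF T(2)]] joinable_mirror[OF joinable_uminus[OF T(3)]]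
      by simp_all
    then have "joinable (mirror T) n a (- b)"
      using joinable_diagonal_pos[OF fillable_mirror[OF T(1)] assms(2)] T(4,5) False by simp
    from joinable_uminus[OF joinable_mirror[OF this]] show ?thesis by simp
  qed
  show ?thesis
  proof (cases "a > 0")
    case True
    then show ?thesis using pos[OF assms(1,3,4)] assms(5,6) by simp
  next
    case False
    have "joinable T n (- a) 0" "joinable T n 0 (- b)"
      using joinable_uminus[OF assms(3)] joinable_uminus[OF assms(4)] by simp_all
    then have "joinable T n (- a) (- b)"
      using pos[OF assms(1)] assms(5,6) False by simp
    from joinable_uminus[OF this] show ?thesis by simp
  qed
qed

definition eventually_joinable :: "tiles \<Rightarrow> nat \<Rightarrow> bool" where
  "eventually_joinable T n \<longleftrightarrow> (\<exists>N. \<forall>a\<ge>N. joinable T n a 0)"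

lemma joinable_near_axis:
  assumes "\<And>c. \<bar>c\<bar> \<ge> N \<Longrightarrow> joinable T (n + k) c 0" "\<bar>a\<bar> \<ge> N" "\<bar>b\<bar> \<le> int k"
  shows "joinable T n a b"
proof (cases "b \<ge> 0")
  case True
  then show ?thesis using joinable_mono[OF assms(1)] assms(2,3) by simp
next
  case False
  then have "joinable T n (- a) (- b)" using joinable_mono[OF assms(1), of "- a" "- b"] assms by simp
  then show ?thesis using joinable_uminus by fastforce
qed

lemma eventually_joinable_abs:
  assumes "eventually_joinable T n"
  obtains N where "\<And>a. \<bar>a\<bar> \<ge> N \<Longrightarrow> joinable T n a 0"
proof -
  obtain N where N: "\<And>a. a \<ge> N \<Longrightarrow> joinable T n a 0"
    using assms unfolding eventually_joinable_def by blast
  have "joinable T n a 0" if "\<bar>a\<bar> \<ge> max N 0" for a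
    using N[of a] N[of "- a"] joinable_uminus[of T n "- a" 0] that by (cases "a \<ge> 0") auto
  then show ?thesis using that by blast
qed

lemma joinable_far:
  assumes "fillable T" "n \<ge> 2"
    and H: "\<forall>n\<ge>2. eventually_joinable T n" and V: "\<forall>n\<ge>2. eventually_joinable (swap_axes T) n"
  shows "\<exists>M. \<forall>a b. \<bar>a\<bar> \<ge> M \<or> \<bar>b\<bar> \<ge> M \<longrightarrow> joinable T n a b"
proof -
  obtain N1 where N1: "\<And>a. \<bar>a\<bar> \<ge> N1 \<Longrightarrow> joinable T n a 0"
    using H assms(2) eventually_joinable_abs by metis
  obtain N2 where N2: "\<And>a. \<bar>a\<bar> \<ge> N2 \<Longrightarrow> joinable (swap_axes T) n a 0"
    using V assms(2) eventually_joinable_abs by metis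
  \<comment> \<open>Where both coordinates exceed \<open>k\<close>, windows of side \<open>n\<close>
    can be joined diagonally; within \<open>k\<close> of an axis, windows of side
    \<open>n + k\<close> absorb the offset. Hence \<open>N3\<close> and \<open>N4\<close> depend on
    \<open>k\<close>.\<close>
  define k where "k = nat (max (max N1 N2) (int n))"
  have k: "n + k \<ge> 2" using assms(2) by simp
  obtain N3 where N3: "\<And>a. \<bar>a\<bar> \<ge> N3 \<Longrightarrow> joinable T (n + k) a 0"
    using H k eventually_joinable_abs by metis
  obtain N4 where N4: "\<And>a. \<bar>a\<bar> \<ge> N4 \<Longrightarrow> joinable (swap_axes T) (n + k) a 0"
    using V k eventually_joinable_abs by metis
  \<comment> \<open>The term \<open>k + 1\<close> makes the far coordinate exceed \<open>k\<close>;
    so if the diagonal case fails, it is the other coordinate that is at most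
    \<open>k\<close>.\<close>
  define M where "M = max (max N3 N4) (int k + 1)"
  have "joinable T n a b" if far: "\<bar>a\<bar> \<ge> M \<or> \<bar>b\<bar> \<ge> M" for a b
  proof -
    consider "\<bar>a\<bar> > int k" "\<bar>b\<bar> > int k" | "\<bar>a\<bar> \<ge> N3" "\<bar>b\<bar> \<le> int k" | "\<bar>b\<bar> \<ge> N4" "\<bar>a\<bar> \<le> int k"
      using far unfolding M_def by linarith
    then show ?thesis
    proof cases
      case 1
      then have "\<bar>a\<bar> \<ge> N1" "\<bar>b\<bar> \<ge> N2" "\<bar>a\<bar> > int n" "\<bar>b\<bar> > int n" by (auto simp: k_def split: if_splits)
      then show ?thesis
        using joinable_diagonal[OF assms(1,2) N1] joinable_swap[OF N2] by simp
    next
      case 2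
      then show ?thesis using joinable_near_axis[OF N3] by blast
    next
      case 3
      then have "joinable (swap_axes T) n b a" using joinable_near_axis[OF N4] by blast
      from joinable_swap[OF this] show ?thesis by simp
    qed
  qed
  then show ?thesis by blast
qed

section \<open>Weak primitivity\<close>

definition column_pair :: "tiles \<Rightarrow> nat \<Rightarrow> (int \<Rightarrow> nat) \<Rightarrow> (int \<Rightarrow> nat) \<Rightarrow> bool" where
  "column_pair T n u w \<longleftrightarrow> (\<forall>y\<in>{0..<int n - 1}. T (u y) (w y) (u (y + 1)) (w (y + 1)))"

text \<open>This is weak \<open>N\<close>-primitivity in terms of words: \<open>u'\<close> and
  \<open>w'\<close> witness that the row of \<open>u\<close> and the column of \<open>w\<close> are
  nonzero, and a strip with \<open>m\<close> columns of blocks, hence \<open>m + 1\<close> columns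
  of sites, is a walk of \<open>m\<close> steps.\<close>

definition strip_joinable :: "tiles \<Rightarrow> nat \<Rightarrow> nat \<Rightarrow> bool" where
  "strip_joinable T n N \<longleftrightarrow> (\<forall>m\<ge>N. \<forall>u u' w w'. column_pair T n u u' \<longrightarrow> column_pair T n w' w \<longrightarrow>
     (\<exists>W. rect_ok T W 0 (int m) 0 (int n - 1) \<and> (\<forall>y\<in>{0..<int n}. W 0 y = u y \<and> W (int m) y = w y)))"

lemma column_pair_tiling:
  assumes "tiling T W"
  shows "column_pair T n (W x) (W (x + 1))"
  using assms by (simp add: tiling_def block_ok_def column_pair_def)

lemma column_pair_extends:
  assumes "fillable T" "n \<ge> 2" "column_pair T n u w"
  obtains W where "tiling T W" "\<And>y. y \<in> {0..<int n} \<Longrightarrow> W 0 y = u y \<and> W 1 y = w y"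
proof -
  define V where "V = (\<lambda>x y. if x = (0::int) then u y else w y)"
  have "rect_ok T V 0 1 0 (int n - 1)"
    using assms(3) by (auto simp: rect_ok_def block_ok_def V_def column_pair_def)
  then obtain W where "tiling T W" "\<forall>u\<in>{0..1}. \<forall>v\<in>{0..int n - 1}. W u v = V u v"
    using rectangle_extends[OF assms(1), of 0 1 0 "int n - 1" V] assms(2) by auto
  then show ?thesis using that[of W] by (auto simp: V_def)
qed

lemma eventually_joinable_if_strip_joinable:
  assumes "fillable T" "n \<ge> 2" "strip_joinable T n N"
  shows "eventually_joinable T n"
proof -
  have "joinable T n a 0" if a: "a \<ge> int (n + N)" for a
    unfolding joinable_def
  proof (intro allI impI)
    fix W1 W2 assume W: "tiling T W1" "tiling T W2"
    define c where "c = int n - 1"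
    \<comment> \<open>The strip runs from the last column \<open>c\<close> of the first window to
      the first column \<open>a\<close> of the second. The columns \<open>c + 1\<close> of
      \<open>W1\<close> and \<open>a - 1\<close> of \<open>W2\<close> are the neighbours that
      \<open>strip_joinable\<close> asks for.\<close>
    define m where "m = nat (a - c)"
    have m: "int m = a - c" "m \<ge> N" "m > 0" using a by (auto simp: m_def c_def)
    obtain S where S: "rect_ok T S 0 (int m) 0 (int n - 1)"
      and S': "\<forall>y\<in>{0..<int n}. S 0 y = W1 c y \<and> S (int m) y = W2 a y"
      using assms(3) m(2) column_pair_tiling[OF W(1), of n c] column_pair_tiling[OF W(2), of n "a - 1"]
      unfolding strip_joinable_def by (metis diff_add_cancel)
    define V where "V = (\<lambda>x y. if x \<le> c then W1 x y else if x < a then S (x - c) y else W2 x y)"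
    have VS: "V x y = S (x - c) y" if "x \<in> {c..a}" "y \<in> {0..<int n}" for x y
      using that S' m by (cases "x = a") (auto simp: V_def)
    have VW: "V x y = W2 x y" if "x \<ge> a" for x y
      using that m by (auto simp: V_def)
    have "block_ok T V x y" if y: "y \<in> {0..<int n - 1}" for x y
    proof -
      consider "x < c" | "x \<in> {c..<a}" | "x \<ge> a" by fastforce
      then show ?thesis
      proof cases
        case 1
        then show ?thesis using W(1) by (simp add: tiling_def block_ok_def V_def)
      next
        case 2
        then have "block_ok T S (x - c) y" using S y m by (auto simp: rect_ok_def)
        then show ?thesis using 2 y by (simp add: block_ok_def VS algebra_simps)
      next
        case 3
        then show ?thesis using W(2) by (simp add: tiling_def block_ok_def VW)
      qed
    qed
    then have "rect_ok T V 0 (a + c) 0 c" by (simp add: rect_ok_def c_def)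
    then obtain W where "tiling T W" and W': "\<forall>u\<in>{0..a + c}. \<forall>v\<in>{0..c}. W u v = V u v"
      using rectangle_extends[OF assms(1), of 0 "a + c" 0 c V] assms(2) a by (auto simp: c_def)
    moreover have "W x y = W1 x y \<and> W (x + a) (y + 0) = W2 (x + a) (y + 0)"
      if "x \<in> {0..<int n}" "y \<in> {0..<int n}" for x y
      using W' VW[of "x + a" y] that a by (auto simp: V_def c_def)
    ultimately show "\<exists>W. tiling T W \<and> (\<forall>x\<in>{0..<int n}. \<forall>y\<in>{0..<int n}.
        W x y = W1 x y \<and> W (x + a) (y + 0) = W2 (x + a) (y + 0))" by blast
  qed
  then show ?thesis unfolding eventually_joinable_def by blast
qed

text \<open>A pair of adjacent columns extends to the plane, so both ends of the required strip
  occur in tilings; a tiling that joins windows around them contains the strip.\<close>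

lemma strip_joinable_if_eventually_joinable:
  assumes "fillable T" "n \<ge> 2" "eventually_joinable T n"
  shows "\<exists>N\<ge>1. strip_joinable T n N"
proof -
  obtain N where N: "\<And>a. a \<ge> N \<Longrightarrow> joinable T n a 0"
    using assms(3) unfolding eventually_joinable_def by blast
  define c where "c = int n - 1"
  have "\<exists>W. rect_ok T W 0 (int m) 0 (int n - 1) \<and> (\<forall>y\<in>{0..<int n}. W 0 y = u y \<and> W (int m) y = w y)"
    if m: "m \<ge> nat N + n" and uw: "column_pair T n u u'" "column_pair T n w' w" for m u u' w' w
  proof -
    obtain W1 where W1: "tiling T W1" "\<And>y. y \<in> {0..<int n} \<Longrightarrow> W1 0 y = u y \<and> W1 1 y = u' y"
      using column_pair_extends[OF assms(1,2) uw(1)] by blast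
    obtain W2 where W2: "tiling T W2" "\<And>y. y \<in> {0..<int n} \<Longrightarrow> W2 0 y = w' y \<and> W2 1 y = w y"
      using column_pair_extends[OF assms(1,2) uw(2)] by blast
    \<comment> \<open>The second window must end in column \<open>m\<close>, so it starts at
      \<open>m - c\<close>. Below, \<open>W2\<close> is shifted so that its column 1, which carries
      \<open>w\<close>, lands on column \<open>m\<close>.\<close>
    let ?a = "int m - c"
    have "?a \<ge> N" using m by (simp add: c_def)
    then obtain W where W: "tiling T W" "\<forall>x\<in>{0..<int n}. \<forall>y\<in>{0..<int n}. W x y = W1 x y \<and>
        W (x + ?a) (y + 0) = W2 (x + ?a + (1 - int m)) (y + 0 + 0)"
      using N[unfolded joinable_def, rule_format, OF _ W1(1) tiling_shift[OF W2(1)]] by blast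
    have "W 0 y = u y \<and> W (int m) y = w y" if "y \<in> {0..<int n}" for y
      using W(2)[rule_format, of 0 y] W(2)[rule_format, of c y] W1(2)[OF that] W2(2)[OF that] that assms(2)
      by (auto simp: c_def)
    then show ?thesis using tiling_rect_ok[OF W(1)] by blast
  qed
  then have "strip_joinable T n (nat N + n)" unfolding strip_joinable_def by blast
  then show ?thesis using assms(2) by (intro exI[of _ "nat N + n"]) simp
qed

section \<open>Powers of zero-one matrices and walks\<close>

lemma pow_mat_pos_iff:
  fixes A :: "real mat"
  assumes A: "A \<in> carrier_mat q q" and nonneg: "\<And>i j. i < q \<Longrightarrow> j < q \<Longrightarrow> A $$ (i, j) \<ge> 0"
    and "i < q" "j < q"
  shows "(A ^\<^sub>m m) $$ (i, j) \<ge> 0 \<and> ((A ^\<^sub>m m) $$ (i, j) > 0 \<longleftrightarrow>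
    (\<exists>f. f 0 = i \<and> f m = j \<and> (\<forall>t\<le>m. f t < q) \<and> (\<forall>t<m. A $$ (f t, f (Suc t)) > 0)))"
  using assms(4)
\<comment> \<open>Non-negativity is carried through the induction so that nothing cancels in the
  product sum: it is positive as soon as one term is nonzero.\<close>
proof (induction m arbitrary: j)
  case 0
  have "(\<exists>f. f (0::nat) = i \<and> f 0 = j \<and> (\<forall>t\<le>0. f t < q)) \<longleftrightarrow> i = j"
    using assms(3) by (auto intro!: exI[of _ "\<lambda>_. j"])
  then show ?case using A assms(3) 0 by auto
next
  case (Suc m)
  have P: "A ^\<^sub>m m \<in> carrier_mat q q" using A by simp
  have eq: "(A ^\<^sub>m Suc m) $$ (i, j) = (\<Sum>k<q. (A ^\<^sub>m m) $$ (i, k) * A $$ (k, j))"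
    using A P assms(3) Suc.prems by (simp add: scalar_prod_def atLeast0LessThan)
  have nn: "(A ^\<^sub>m m) $$ (i, k) * A $$ (k, j) \<ge> 0" if "k < q" for k
    using Suc.IH[OF that] nonneg[OF that Suc.prems] by simp
  have "(A ^\<^sub>m Suc m) $$ (i, j) > 0 \<longleftrightarrow> (\<exists>k<q. (A ^\<^sub>m m) $$ (i, k) * A $$ (k, j) \<noteq> 0)"
    unfolding eq using sum_nonneg_eq_0_iff[of "{..<q}" "\<lambda>k. (A ^\<^sub>m m) $$ (i, k) * A $$ (k, j)"]
      sum_nonneg[of "{..<q}" "\<lambda>k. (A ^\<^sub>m m) $$ (i, k) * A $$ (k, j)"] nn by force
  also have "\<dots> \<longleftrightarrow> (\<exists>k<q. (A ^\<^sub>m m) $$ (i, k) > 0 \<and> A $$ (k, j) > 0)"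
    using Suc.IH nonneg[OF _ Suc.prems] by (metis less_eq_real_def mult_eq_0_iff order_less_irrefl)
  also have "\<dots> \<longleftrightarrow> (\<exists>f. f 0 = i \<and> f (Suc m) = j \<and> (\<forall>t\<le>Suc m. f t < q) \<and>
    (\<forall>t<Suc m. A $$ (f t, f (Suc t)) > 0))" (is "_ \<longleftrightarrow> (\<exists>f. ?path f)")
  proof
    assume "\<exists>k<q. (A ^\<^sub>m m) $$ (i, k) > 0 \<and> A $$ (k, j) > 0"
    then obtain k f where "k < q" "A $$ (k, j) > 0" "f 0 = i" "f m = k" "\<forall>t\<le>m. f t < q"
      "\<forall>t<m. A $$ (f t, f (Suc t)) > 0"
      using Suc.IH by blast
    then have "?path (f(Suc m := j))" using Suc.prems by (auto simp: less_Suc_eq le_Suc_eq)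
    then show "\<exists>f. ?path f" by blast
  next
    assume "\<exists>f. ?path f"
    then obtain f where f: "?path f" by blast
    then have "f m < q" "A $$ (f m, j) > 0" by auto
    moreover have "(A ^\<^sub>m m) $$ (i, f m) > 0"
      using Suc.IH[OF \<open>f m < q\<close>] f by (metis le_SucI less_SucI)
    ultimately show "\<exists>k<q. (A ^\<^sub>m m) $$ (i, k) > 0 \<and> A $$ (k, j) > 0" by blast
  qed
  finally have "(A ^\<^sub>m Suc m) $$ (i, j) > 0 \<longleftrightarrow> (\<exists>f. ?path f)" .
  moreover have "(A ^\<^sub>m Suc m) $$ (i, j) \<ge> 0"
    unfolding eq using nn by (intro sum_nonneg) simp
  ultimately show ?case by simp
qed

lemma weakly_primitive_zero_one_mat:
  fixes R :: "nat \<Rightarrow> nat \<Rightarrow> bool" and q :: nat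
  defines "A \<equiv> mat q q (\<lambda>(i, j). if R i j then 1 else 0) :: real mat"
  shows "weakly_primitive A \<longleftrightarrow> (\<exists>N\<ge>1. \<forall>m\<ge>N. \<forall>i<q. \<forall>j<q. (\<exists>k<q. R i k) \<and> (\<exists>k<q. R k j) \<longrightarrow>
    (\<exists>f. f 0 = i \<and> f m = j \<and> (\<forall>t\<le>m. f t < q) \<and> (\<forall>t<m. R (f t) (f (Suc t)))))"
proof -
  have [simp]: "dim_row A = q" "dim_col A = q" by (simp_all add: A_def)
  have Aij: "A $$ (i, j) = (if R i j then 1 else 0)" if "i < q" "j < q" for i j
    using that by (simp add: A_def)
  have nonneg: "nonneg_square_mat A" by (simp add: nonneg_square_mat_def Aij)
  have rows: "row A i \<noteq> 0\<^sub>v q \<longleftrightarrow> (\<exists>k<q. R i k)" if "i < q" for i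
    using that by (auto simp: vec_eq_iff Aij split: if_splits)
  have cols: "col A j \<noteq> 0\<^sub>v q \<longleftrightarrow> (\<exists>k<q. R k j)" if "j < q" for j
    using that by (auto simp: vec_eq_iff Aij split: if_splits)
  have pow: "(A ^\<^sub>m m) $$ (i, j) > 0 \<longleftrightarrow> (\<exists>f. f 0 = i \<and> f m = j \<and> (\<forall>t\<le>m. f t < q) \<and>
      (\<forall>t<m. R (f t) (f (Suc t))))" if "i < q" "j < q" for i j m
  proof -
    have pos: "A $$ (k, l) > 0 \<longleftrightarrow> R k l" "A $$ (k, l) \<ge> 0" if "k < q" "l < q" for k l
      using that by (simp_all add: Aij)
    have steps: "(\<forall>t<m. A $$ (f t, f (Suc t)) > 0) \<longleftrightarrow> (\<forall>t<m. R (f t) (f (Suc t)))"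
      if "\<forall>t\<le>m. f t < q" for f
      by (rule all_cong1, rule imp_cong, rule refl, rule pos) (use that in auto)
    have "A \<in> carrier_mat q q" by (simp add: A_def)
    note pow_mat_pos_iff[OF this pos(2) that, THEN conjunct2]
    also have "(\<exists>f. f 0 = i \<and> f m = j \<and> (\<forall>t\<le>m. f t < q) \<and> (\<forall>t<m. A $$ (f t, f (Suc t)) > 0)) \<longleftrightarrow>
      (\<exists>f. f 0 = i \<and> f m = j \<and> (\<forall>t\<le>m. f t < q) \<and> (\<forall>t<m. R (f t) (f (Suc t))))"
      by (rule ex_cong1, rule conj_cong, rule refl, rule conj_cong, rule refl, rule conj_cong,
          rule refl, rule steps)
    finally show ?thesis by simp
  qed
  have entry: "(row A i \<noteq> 0\<^sub>v q \<and> col A j \<noteq> 0\<^sub>v q \<longrightarrow> (A ^\<^sub>m m) $$ (i, j) > 0) \<longleftrightarrow>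
    ((\<exists>k<q. R i k) \<and> (\<exists>k<q. R k j) \<longrightarrow>
      (\<exists>f. f 0 = i \<and> f m = j \<and> (\<forall>t\<le>m. f t < q) \<and> (\<forall>t<m. R (f t) (f (Suc t)))))"
    if "i < q" "j < q" for i j m
    unfolding rows[OF that(1)] cols[OF that(2)] pow[OF that] ..
  have "(\<forall>m\<ge>N. \<forall>i<q. \<forall>j<q. row A i \<noteq> 0\<^sub>v q \<and> col A j \<noteq> 0\<^sub>v q \<longrightarrow> (A ^\<^sub>m m) $$ (i, j) > 0) \<longleftrightarrow>
    (\<forall>m\<ge>N. \<forall>i<q. \<forall>j<q. (\<exists>k<q. R i k) \<and> (\<exists>k<q. R k j) \<longrightarrow>
      (\<exists>f. f 0 = i \<and> f m = j \<and> (\<forall>t\<le>m. f t < q) \<and> (\<forall>t<m. R (f t) (f (Suc t)))))" for N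
    by (rule all_cong1, rule imp_cong, rule refl, rule all_cong1, rule imp_cong, rule refl,
        rule all_cong1, rule imp_cong, rule refl, rule entry)
  then show ?thesis
    unfolding weakly_primitive_def weakly_N_primitive_def \<open>dim_row A = q\<close> \<open>dim_col A = q\<close>
    by (simp only: nonneg simp_thms)
qed

section \<open>Words as numbers in base p\<close>

lemma psi_Suc: "psi p (Suc n) u = Suc (p * (psi p n u - 1) + u (Suc n))"
proof -
  have "(\<Sum>k = 1..n. u k * p ^ (Suc n - k)) = p * (\<Sum>k = 1..n. u k * p ^ (n - k))"
    unfolding sum_distrib_left by (intro sum.cong) (auto simp: Suc_diff_le)
  then show ?thesis by (simp add: psi_def)
qed

text \<open>Induction on the last and least significant letter: \<open>i div p\<close> belongs to
  the word without it.\<close>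

lemma psi_digits:
  assumes "i < p ^ n"
  shows "psi p n (\<lambda>k. i div p ^ (n - k) mod p) = Suc i"
  using assms
proof (induction n arbitrary: i)
  case 0
  then show ?case by (simp add: psi_def)
next
  case (Suc n)
  have "psi p n (\<lambda>k. i div p ^ (Suc n - k) mod p) = psi p n (\<lambda>k. i div p div p ^ (n - k) mod p)"
    unfolding psi_def by (intro arg_cong2[of _ _ _ _ "(+)"] sum.cong refl)
      (auto simp: Suc_diff_le div_mult2_eq)
  also have "\<dots> = Suc (i div p)"
    using Suc.IH[of "i div p"] Suc.prems by (simp add: less_mult_imp_div_less mult.commute)
  finally show ?case by (simp add: psi_Suc)
qed

lemma digits_psi:
  assumes "\<And>k. k \<in> {1..n} \<Longrightarrow> u k < p" "psi p n u = Suc i"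
  shows "i < p ^ n \<and> (\<forall>k\<in>{1..n}. i div p ^ (n - k) mod p = u k)"
  using assms
proof (induction n arbitrary: i)
  case 0
  then show ?case by (simp add: psi_def)
next
  case (Suc n)
  have un: "u (Suc n) < p" using Suc.prems(1) by simp
  have i: "i = p * (psi p n u - 1) + u (Suc n)" using Suc.prems(2) by (simp add: psi_Suc)
  then have d: "i div p = psi p n u - 1" "i mod p = u (Suc n)" using un by auto
  have "psi p n u = Suc (i div p)" unfolding d by (simp add: psi_def)
  then have IH: "i div p < p ^ n" "\<forall>k\<in>{1..n}. i div p div p ^ (n - k) mod p = u k"
    using Suc.IH Suc.prems(1) by auto
  have "i < p ^ Suc n" using IH(1) un by (simp add: div_less_iff_less_mult mult.commute)
  moreover have "i div p ^ (Suc n - k) mod p = u k" if "k \<in> {1..Suc n}" for k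
    using IH(2) d(2) that by (cases "k = Suc n") (auto simp: Suc_diff_le div_mult2_eq)
  ultimately show ?case by blast
qed

text \<open>Both counts start at 0 here: site \<open>y\<close> carries the letter with number
  \<open>y + 1\<close>, and the index is one less than the value of \<open>psi\<close>.\<close>

definition encode :: "nat \<Rightarrow> nat \<Rightarrow> (int \<Rightarrow> nat) \<Rightarrow> nat" where
  "encode p n u = psi p n (\<lambda>k. u (int k - 1)) - 1"

definition decode :: "nat \<Rightarrow> nat \<Rightarrow> nat \<Rightarrow> int \<Rightarrow> nat" where
  "decode p n i y = i div p ^ (n - nat (y + 1)) mod p"

lemma Suc_encode: "Suc (encode p n u) = psi p n (\<lambda>k. u (int k - 1))"
  by (simp add: encode_def psi_def)

lemma encode_decode:
  assumes "i < p ^ n" "\<And>y. y \<in> {0..<int n} \<Longrightarrow> u y = decode p n i y"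
  shows "encode p n u = i"
proof -
  have "psi p n (\<lambda>k. u (int k - 1)) = psi p n (\<lambda>k. i div p ^ (n - k) mod p)"
    unfolding psi_def using assms(2)
    by (intro arg_cong2[of _ _ _ _ "(+)"] sum.cong refl) (auto simp: decode_def)
  then show ?thesis using psi_digits[OF assms(1)] by (simp add: encode_def)
qed

lemma decode_encode:
  assumes "\<And>y. y \<in> {0..<int n} \<Longrightarrow> u y < p"
  shows "encode p n u < p ^ n" "y \<in> {0..<int n} \<Longrightarrow> decode p n (encode p n u) y = u y"
proof -
  have *: "encode p n u < p ^ n \<and>
      (\<forall>k\<in>{1..n}. encode p n u div p ^ (n - k) mod p = u (int k - 1))"
    using assms by (intro digits_psi) (auto simp: Suc_encode)
  then show "encode p n u < p ^ n" by blast
  assume "y \<in> {0..<int n}"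
  moreover from this have "nat (y + 1) \<in> {1..n}" by (auto simp: nat_le_iff Suc_le_eq)
  ultimately show "decode p n (encode p n u) y = u y"
    using *[THEN conjunct2, rule_format, of "nat (y + 1)"] by (auto simp: decode_def)
qed

section \<open>Strips as walks of column words\<close>

lemma column_pair_cong:
  assumes "\<And>y. y \<in> {0..<int n} \<Longrightarrow> u y = u' y \<and> w y = w' y"
  shows "column_pair T n u w \<longleftrightarrow> column_pair T n u' w'"
  unfolding column_pair_def
proof (rule ball_cong[OF refl])
  fix y assume "y \<in> {0..<int n - 1}"
  then have "y \<in> {0..<int n}" "y + 1 \<in> {0..<int n}" by auto
  then show "T (u y) (w y) (u (y + 1)) (w (y + 1)) = T (u' y) (w' y) (u' (y + 1)) (w' (y + 1))"
    using assms by simp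
qed

text \<open>By \<open>n \<ge> 2\<close> every site of the two columns lies in a block; the top site
  is the only one that has to use the block below it.\<close>

lemma column_pair_less:
  assumes "\<And>a b c d. T a b c d \<Longrightarrow> a < p \<and> b < p \<and> c < p \<and> d < p" "column_pair T n u w" "n \<ge> 2"
    and y: "y \<in> {0..<int n}"
  shows "u y < p \<and> w y < p"
proof (cases "y = int n - 1")
  case True
  then have "y - 1 \<in> {0..<int n - 1}" using assms(3) by auto
  then have "T (u (y - 1)) (w (y - 1)) (u (y - 1 + 1)) (w (y - 1 + 1))"
    using assms(2) unfolding column_pair_def by blast
  then show ?thesis using assms(1)[of _ _ "u y" "w y"] by simp
next
  case False
  then have "T (u y) (w y) (u (y + 1)) (w (y + 1))"
    using assms(2) y unfolding column_pair_def by auto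
  then show ?thesis using assms(1) by blast
qed

text \<open>Read column by column, a strip of height \<open>n\<close> is a walk of indices. A strip
  may a priori carry any numbers; encoding its columns loses nothing because each of them belongs to
  an admissible pair and hence uses only colours below \<open>p\<close>.\<close>

lemma weakly_primitive_iff_strip_joinable:
  assumes colours: "\<And>a b c d. T a b c d \<Longrightarrow> a < p \<and> b < p \<and> c < p \<and> d < p"
    and n: "n \<ge> 2"
    and R: "\<And>i j. i < p ^ n \<Longrightarrow> j < p ^ n \<Longrightarrow> R i j \<longleftrightarrow> column_pair T n (decode p n i) (decode p n j)"
  shows "weakly_primitive (mat (p ^ n) (p ^ n) (\<lambda>(i, j). if R i j then 1 else 0) :: real mat) \<longleftrightarrow>
    (\<exists>N\<ge>1. strip_joinable T n N)"
proof -
  let ?I = "{0..<int n}" and ?q = "p ^ n"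
  have less: "u y < p \<and> w y < p" if "column_pair T n u w" "y \<in> ?I" for u w y
    by (rule column_pair_less[OF _ that(1) n that(2)]) (rule colours)
  have R': "R (encode p n u) (encode p n w)" if "column_pair T n u w" for u w
  proof -
    have uw: "\<And>y. y \<in> ?I \<Longrightarrow> u y < p" "\<And>y. y \<in> ?I \<Longrightarrow> w y < p" using less[OF that] by auto
    have "column_pair T n (decode p n (encode p n u)) (decode p n (encode p n w))"
    proof -
      have "decode p n (encode p n u) y = u y \<and> decode p n (encode p n w) y = w y" if "y \<in> ?I" for y
        using decode_encode(2)[of n u p y] decode_encode(2)[of n w p y] uw that by blast
      then show ?thesis
        using that column_pair_cong[of n "decode p n (encode p n u)" u "decode p n (encode p n w)" w T]
        by simp
    qed
    then show ?thesis using R[OF decode_encode(1)[of n u p] decode_encode(1)[of n w p]] uw by simp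
  qed
  have key: "(\<forall>i<?q. \<forall>j<?q. (\<exists>k<?q. R i k) \<and> (\<exists>k<?q. R k j) \<longrightarrow>
      (\<exists>f. f 0 = i \<and> f m = j \<and> (\<forall>t\<le>m. f t < ?q) \<and> (\<forall>t<m. R (f t) (f (Suc t))))) \<longleftrightarrow>
    (\<forall>u u' w w'. column_pair T n u u' \<longrightarrow> column_pair T n w' w \<longrightarrow>
     (\<exists>W. rect_ok T W 0 (int m) 0 (int n - 1) \<and> (\<forall>y\<in>?I. W 0 y = u y \<and> W (int m) y = w y)))"
    (is "?paths \<longleftrightarrow> ?strips") if m: "m \<ge> 1" for m
  proof
    assume paths: ?paths
    show ?strips
    proof (intro allI impI)
      fix u u' w w' assume uw: "column_pair T n u u'" "column_pair T n w' w"
      have lt: "\<And>y. y \<in> ?I \<Longrightarrow> u y < p" "\<And>y. y \<in> ?I \<Longrightarrow> u' y < p" "\<And>y. y \<in> ?I \<Longrightarrow> w y < p"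
        "\<And>y. y \<in> ?I \<Longrightarrow> w' y < p"
        using less[OF uw(1)] less[OF uw(2)] by auto
      have enc: "encode p n u < ?q" "encode p n u' < ?q" "encode p n w < ?q" "encode p n w' < ?q"
        by (rule decode_encode(1), rule lt, assumption)+
      then have ends: "(\<exists>k<?q. R (encode p n u) k) \<and> (\<exists>k<?q. R k (encode p n w))"
        using R'[OF uw(1)] R'[OF uw(2)] by blast
      obtain f where f: "f 0 = encode p n u" "f m = encode p n w" "\<forall>t\<le>m. f t < ?q"
        "\<forall>t<m. R (f t) (f (Suc t))"
        using paths[THEN spec, THEN mp, OF enc(1), THEN spec, THEN mp, OF enc(3), THEN mp, OF ends]
        by blast
      define W where "W = (\<lambda>x. decode p n (f (nat x)))"
      have "block_ok T W x y" if x: "x \<in> {0..<int m}" and y: "y \<in> {0..<int n - 1}" for x y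
      proof -
        have "nat x < m" using x by auto
        then have "column_pair T n (W x) (decode p n (f (Suc (nat x))))"
          using f(3,4) R unfolding W_def by (metis Suc_leI less_imp_le)
        moreover have "nat (x + 1) = Suc (nat x)" using x by auto
        ultimately show ?thesis using y by (simp add: column_pair_def block_ok_def W_def)
      qed
      then have "rect_ok T W 0 (int m) 0 (int n - 1)" by (simp add: rect_ok_def)
      moreover have "\<forall>y\<in>?I. W 0 y = u y \<and> W (int m) y = w y"
        using decode_encode(2)[OF lt(1)] decode_encode(2)[OF lt(3)] by (simp add: W_def f(1,2))
      ultimately show "\<exists>W. rect_ok T W 0 (int m) 0 (int n - 1) \<and>
        (\<forall>y\<in>?I. W 0 y = u y \<and> W (int m) y = w y)" by blast
    qed
  next
    assume strips: ?strips
    show ?paths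
    proof (intro allI impI)
      fix i j assume ij: "i < ?q" "j < ?q" "(\<exists>k<?q. R i k) \<and> (\<exists>k<?q. R k j)"
      then obtain u' w' where "column_pair T n (decode p n i) u'" "column_pair T n w' (decode p n j)"
        using R by blast
      then obtain W where W: "rect_ok T W 0 (int m) 0 (int n - 1)"
        and ends: "\<forall>y\<in>?I. W 0 y = decode p n i y \<and> W (int m) y = decode p n j y"
        using strips by blast
      define f where "f = (\<lambda>t. encode p n (W (int t)))"
      have step: "column_pair T n (W (int t)) (W (int t + 1))" if "t < m" for t
        using W that by (simp add: column_pair_def rect_ok_def block_ok_def)
      have "R (f t) (f (Suc t))" if "t < m" for t
        using R'[OF step[OF that]] by (simp add: f_def add.commute)
      moreover have "f t < ?q" if "t \<le> m" for t
      proof -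
        \<comment> \<open>The last column has no right neighbour in the strip, but it is the right
          member of the pair starting at \<open>m - 1\<close>, which exists by
          \<open>m \<ge> 1\<close>.\<close>
        have "W (int t) y < p" if y: "y \<in> ?I" for y
        proof (cases "t = m")
          case True
          then show ?thesis using less[OF step[of "m - 1"] y] m by (simp add: of_nat_diff)
        next
          case False
          then show ?thesis using less[OF step[of t] y] \<open>t \<le> m\<close> by simp
        qed
        then show ?thesis unfolding f_def by (rule decode_encode(1))
      qed
      moreover have "f 0 = i" "f m = j" using encode_decode ij ends by (simp_all add: f_def)
      ultimately show "\<exists>f. f 0 = i \<and> f m = j \<and> (\<forall>t\<le>m. f t < ?q) \<and> (\<forall>t<m. R (f t) (f (Suc t)))"
        by blast
    qed
  qed
  show ?thesis unfolding weakly_primitive_zero_one_mat strip_joinable_def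
    by (rule ex_cong1, rule conj_cong, rule refl, rule all_cong1, rule imp_cong, rule refl, rule key) simp
qed

section \<open>Patterns as tile predicates\<close>

text \<open>The restriction makes it extensional, so a translated window of a pattern is equal to
  the \<open>tile_pattern\<close> of its four colours, and membership in \<open>B\<close> depends on
  these alone.\<close>

definition tile_pattern :: "nat \<Rightarrow> nat \<Rightarrow> nat \<Rightarrow> nat \<Rightarrow> pattern" where
  "tile_pattern a b c d = restrict (\<lambda>(x, y). if y = 0 then if x = 0 then a else b
     else if x = 0 then c else d) (lattice_rect 2 2)"

definition tiles_of :: "pattern set \<Rightarrow> tiles" where
  "tiles_of B a b c d \<longleftrightarrow> tile_pattern a b c d \<in> B"

lemma lattice_at_2_2: "lattice_at 2 2 (x, y) = {(x, y), (x + 1, y), (x, y + 1), (x + 1, y + 1)}"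
proof -
  have "n < 2 \<longleftrightarrow> n = 0 \<or> n = 1" for n :: nat by auto
  then show ?thesis unfolding lattice_at_def by fastforce
qed

lemma lattice_rect_eq: "lattice_rect m n = {0..<int m} \<times> {0..<int n}"
proof (intro subset_antisym subsetI)
  fix s assume "s \<in> {0..<int m} \<times> {0..<int n}"
  then have "s = (0, 0) + (int (nat (fst s)), int (nat (snd s))) \<and> nat (fst s) < m \<and> nat (snd s) < n"
    by (auto simp: prod_eq_iff)
  then show "s \<in> lattice_rect m n" unfolding lattice_rect_def lattice_at_def by blast
qed (auto simp: lattice_rect_def lattice_at_def)

lemma restrict_window:
  "restrict (\<lambda>s. U ((x, y) + s)) (lattice_rect 2 2) =
    tile_pattern (U (x, y)) (U (x + 1, y)) (U (x, y + 1)) (U (x + 1, y + 1))"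
  unfolding tile_pattern_def
proof (rule restrict_ext)
  fix s :: site assume "s \<in> lattice_rect 2 2"
  then consider "s = (0, 0)" | "s = (1, 0)" | "s = (0, 1)" | "s = (1, 1)"
    using lattice_at_2_2[of 0 0] by (auto simp: lattice_rect_def)
  then show "U ((x, y) + s) = (case s of (u, v) \<Rightarrow> if v = 0 then if u = 0 then U (x, y) else U (x + 1, y)
      else if u = 0 then U (x, y + 1) else U (x + 1, y + 1))"
    by cases simp_all
qed

lemma admissible_iff:
  "admissible B R U \<longleftrightarrow> (\<forall>x y. {(x, y), (x + 1, y), (x, y + 1), (x + 1, y + 1)} \<subseteq> R \<longrightarrow>
    block_ok (tiles_of B) (curry U) x y)"
  unfolding admissible_def split_paired_All lattice_at_2_2 restrict_window tiles_of_def block_ok_def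
    curry_conv by (rule refl)

lemma tiles_of_tile_pattern:
  assumes "restrict U (lattice_rect 2 2) = tile_pattern a b c d"
  shows "U (0, 0) = a" "U (1, 0) = b" "U (0, 1) = c" "U (1, 1) = d"
proof -
  have eq: "U s = tile_pattern a b c d s" if "s \<in> lattice_rect 2 2" for s
    using fun_cong[OF assms, of s] that by simp
  show "U (0, 0) = a" "U (1, 0) = b" "U (0, 1) = c" "U (1, 1) = d"
    by (subst eq; simp add: tile_pattern_def lattice_rect_eq)+
qed

lemma tiles_of_less:
  assumes "B \<subseteq> all_patterns p (lattice_rect 2 2)" "tiles_of B a b c d"
  shows "a < p \<and> b < p \<and> c < p \<and> d < p"
proof -
  have "tile_pattern a b c d \<in> lattice_rect 2 2 \<rightarrow>\<^sub>E {..<p}"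
    using assms by (auto simp: tiles_of_def all_patterns_def)
  then have *: "tile_pattern a b c d s < p" if "s \<in> lattice_rect 2 2" for s
    using that by (metis PiE_mem lessThan_iff)
  show ?thesis using *[of "(0, 0)"] *[of "(1, 0)"] *[of "(0, 1)"] *[of "(1, 1)"]
    by (simp add: tile_pattern_def lattice_rect_eq)
qed

lemma extendable_tiles_of:
  assumes "locally_crisscross_extendable p B"
  shows "extendable (tiles_of B)"
  unfolding extendable_def
proof (intro allI impI)
  fix a b c d assume "tiles_of B a b c d"
  then obtain U where adm: "admissible B crisscross_lattice U"
    and U: "restrict U (lattice_rect 2 2) = tile_pattern a b c d"
    using assms unfolding locally_crisscross_extendable_def tiles_of_def admissible_patterns_def by blast
  note U = tiles_of_tile_pattern[OF U]
  have *: "block_ok (tiles_of B) (curry U) x y" if "\<bar>x\<bar> + \<bar>y\<bar> \<le> 1" for x y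
  proof -
    have "lattice_at 2 2 (x, y) \<subseteq> crisscross_lattice" using that by (auto simp: crisscross_lattice_def)
    then show ?thesis using adm by (simp add: admissible_iff lattice_at_2_2)
  qed
  have "tiles_of B b (U (2, 0)) d (U (2, 1))" "tiles_of B (U (- 1, 0)) a (U (- 1, 1)) c"
    "tiles_of B c d (U (0, 2)) (U (1, 2))" "tiles_of B (U (0, - 1)) (U (1, - 1)) a b"
    using *[of 1 0] *[of "- 1" 0] *[of 0 1] *[of 0 "- 1"] by (simp_all add: block_ok_def U)
  then show "(\<exists>e f. tiles_of B b e d f) \<and> (\<exists>e f. tiles_of B e a f c) \<and>
    (\<exists>e f. tiles_of B c d e f) \<and> (\<exists>e f. tiles_of B e f a b)" by blast
qed

section \<open>Corner conditions on 3 by 3 squares\<close>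

lemma corner_fill:
  assumes "locally_corner_extendable p B k" "\<And>s. s \<in> L_lattice k \<Longrightarrow> W s < p"
    and "\<And>x y. x = 0 \<or> x = 1 \<Longrightarrow> y = 0 \<or> y = 1 \<Longrightarrow>
      {(x, y), (x + 1, y), (x, y + 1), (x + 1, y + 1)} \<subseteq> L_lattice k \<Longrightarrow> block_ok (tiles_of B) (curry W) x y"
  obtains W' where "\<And>s. s \<in> L_lattice k \<Longrightarrow> W' s = W s"
    "\<And>x y. x \<in> {0, 1} \<Longrightarrow> y \<in> {0, 1} \<Longrightarrow> block_ok (tiles_of B) (curry W') x y"
proof -
  have "block_ok (tiles_of B) (curry (restrict W (L_lattice k))) x y"
    if "{(x, y), (x + 1, y), (x, y + 1), (x + 1, y + 1)} \<subseteq> L_lattice k" for x y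
  proof -
    \<comment> \<open>A block within the 3 by 3 square starts at one of four sites, so each use of
      the lemma has only four positions to inspect.\<close>
    have "(x, y) \<in> lattice_rect 3 3" "(x + 1, y + 1) \<in> lattice_rect 3 3"
      using that by (auto simp: L_lattice_def)
    then have "x = 0 \<or> x = 1" "y = 0 \<or> y = 1" by (auto simp: lattice_rect_eq)
    from assms(3)[OF this that] show ?thesis using that by (simp add: block_ok_def)
  qed
  then have "restrict W (L_lattice k) \<in> admissible_patterns p B (L_lattice k)"
    using assms(2) by (auto simp: admissible_patterns_def all_patterns_def admissible_iff)
  then obtain U where adm: "admissible B (lattice_rect 3 3) U"
    and U: "restrict U (L_lattice k) = restrict W (L_lattice k)"
    using assms(1) unfolding locally_corner_extendable_def admissible_patterns_def by blast
  have "U s = W s" if "s \<in> L_lattice k" for s using fun_cong[OF U, of s] that by simp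
  moreover have "block_ok (tiles_of B) (curry U) x y" if "x \<in> {0, 1}" "y \<in> {0, 1}" for x y
    using adm that by (auto simp: admissible_iff lattice_rect_eq)
  ultimately show ?thesis using that by blast
qed

text \<open>The rows are listed from bottom to top, so that the list index is the height.\<close>

definition grid :: "nat list list \<Rightarrow> site \<Rightarrow> nat" where
  "grid g = (\<lambda>(x, y). g ! nat y ! nat x)"

lemma lattice_rect_3_3: "lattice_rect 3 3 = {0, 1, 2} \<times> {0, 1, 2}"
proof -
  have "{0..<3} = {0, 1, 2 :: int}" by auto
  then show ?thesis by (simp add: lattice_rect_eq)
qed

text \<open>The L-shape contains exactly three blocks, the ones assumed admissible; the block
  completed by the new site starts at \<open>(1, 1)\<close>. The other corners differ only in the
  position of the missing site.\<close>

lemma corner_ur_tiles_of: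
  assumes "B \<subseteq> all_patterns p (lattice_rect 2 2)" "locally_corner_extendable p B 1"
  shows "corner_ur (tiles_of B)"
  unfolding corner_ur_def
proof (intro allI impI)
  fix a b c d e f g h
  \<comment> \<open>The entry 0 is a filler at the missing site, which lies outside
    \<open>L_lattice 1\<close>.\<close>
  let ?W = "grid [[a, b, c], [d, e, f], [g, h, 0]]"
  assume T: "tiles_of B a b d e" "tiles_of B b c e f" "tiles_of B d e g h"
  note lt = T[THEN tiles_of_less[OF assms(1)]]
  obtain W' where "\<And>s. s \<in> L_lattice 1 \<Longrightarrow> W' s = ?W s"
    "\<And>x y. x \<in> {0, 1} \<Longrightarrow> y \<in> {0, 1} \<Longrightarrow> block_ok (tiles_of B) (curry W') x y"
  proof (rule corner_fill[OF assms(2)])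
    show "?W s < p" if "s \<in> L_lattice 1" for s
      using that lt by (auto simp: L_lattice_def lattice_rect_3_3 grid_def)
    show "block_ok (tiles_of B) (curry ?W) x y"
      if "x = 0 \<or> x = 1" "y = 0 \<or> y = 1"
        "{(x, y), (x + 1, y), (x, y + 1), (x + 1, y + 1)} \<subseteq> L_lattice 1" for x y
      using that T by (elim disjE) (simp_all add: L_lattice_def lattice_rect_3_3 grid_def block_ok_def)
  qed blast
  from this(1)[of "(1, 1)"] this(1)[of "(2, 1)"] this(1)[of "(1, 2)"] this(2)[of 1 1]
  have "tiles_of B e f h (W' (2, 2))"
    by (simp add: L_lattice_def lattice_rect_3_3 grid_def block_ok_def)
  then show "\<exists>i. tiles_of B e f h i" ..
qed

lemma corner_ul_tiles_of:
  assumes "B \<subseteq> all_patterns p (lattice_rect 2 2)" "locally_corner_extendable p B 2"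
  shows "corner_ul (tiles_of B)"
  unfolding corner_ul_def
proof (intro allI impI)
  fix a b c d e f h i
  let ?W = "grid [[a, b, c], [d, e, f], [0, h, i]]"
  assume T: "tiles_of B a b d e" "tiles_of B b c e f" "tiles_of B e f h i"
  note lt = T[THEN tiles_of_less[OF assms(1)]]
  obtain W' where "\<And>s. s \<in> L_lattice 2 \<Longrightarrow> W' s = ?W s"
    "\<And>x y. x \<in> {0, 1} \<Longrightarrow> y \<in> {0, 1} \<Longrightarrow> block_ok (tiles_of B) (curry W') x y"
  proof (rule corner_fill[OF assms(2)])
    show "?W s < p" if "s \<in> L_lattice 2" for s
      using that lt by (auto simp: L_lattice_def lattice_rect_3_3 grid_def)
    show "block_ok (tiles_of B) (curry ?W) x y"
      if "x = 0 \<or> x = 1" "y = 0 \<or> y = 1"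
        "{(x, y), (x + 1, y), (x, y + 1), (x + 1, y + 1)} \<subseteq> L_lattice 2" for x y
      using that T by (elim disjE) (simp_all add: L_lattice_def lattice_rect_3_3 grid_def block_ok_def)
  qed blast
  from this(1)[of "(0, 1)"] this(1)[of "(1, 1)"] this(1)[of "(1, 2)"] this(2)[of 0 1]
  have "tiles_of B d e (W' (0, 2)) h"
    by (simp add: L_lattice_def lattice_rect_3_3 grid_def block_ok_def)
  then show "\<exists>g. tiles_of B d e g h" ..
qed

lemma corner_ll_tiles_of:
  assumes "B \<subseteq> all_patterns p (lattice_rect 2 2)" "locally_corner_extendable p B 3"
  shows "corner_ll (tiles_of B)"
  unfolding corner_ll_def
proof (intro allI impI)
  fix b c d e f g h i
  let ?W = "grid [[0, b, c], [d, e, f], [g, h, i]]"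
  assume T: "tiles_of B b c e f" "tiles_of B d e g h" "tiles_of B e f h i"
  note lt = T[THEN tiles_of_less[OF assms(1)]]
  obtain W' where "\<And>s. s \<in> L_lattice 3 \<Longrightarrow> W' s = ?W s"
    "\<And>x y. x \<in> {0, 1} \<Longrightarrow> y \<in> {0, 1} \<Longrightarrow> block_ok (tiles_of B) (curry W') x y"
  proof (rule corner_fill[OF assms(2)])
    show "?W s < p" if "s \<in> L_lattice 3" for s
      using that lt by (auto simp: L_lattice_def lattice_rect_3_3 grid_def)
    show "block_ok (tiles_of B) (curry ?W) x y"
      if "x = 0 \<or> x = 1" "y = 0 \<or> y = 1"
        "{(x, y), (x + 1, y), (x, y + 1), (x + 1, y + 1)} \<subseteq> L_lattice 3" for x y
      using that T by (elim disjE) (simp_all add: L_lattice_def lattice_rect_3_3 grid_def block_ok_def)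
  qed blast
  from this(1)[of "(1, 0)"] this(1)[of "(0, 1)"] this(1)[of "(1, 1)"] this(2)[of 0 0]
  have "tiles_of B (W' (0, 0)) b d e"
    by (simp add: L_lattice_def lattice_rect_3_3 grid_def block_ok_def)
  then show "\<exists>a. tiles_of B a b d e" ..
qed

lemma corner_lr_tiles_of:
  assumes "B \<subseteq> all_patterns p (lattice_rect 2 2)" "locally_corner_extendable p B 4"
  shows "corner_lr (tiles_of B)"
  unfolding corner_lr_def
proof (intro allI impI)
  fix a b d e f g h i
  let ?W = "grid [[a, b, 0], [d, e, f], [g, h, i]]"
  assume T: "tiles_of B a b d e" "tiles_of B d e g h" "tiles_of B e f h i"
  note lt = T[THEN tiles_of_less[OF assms(1)]]
  obtain W' where "\<And>s. s \<in> L_lattice 4 \<Longrightarrow> W' s = ?W s"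
    "\<And>x y. x \<in> {0, 1} \<Longrightarrow> y \<in> {0, 1} \<Longrightarrow> block_ok (tiles_of B) (curry W') x y"
  proof (rule corner_fill[OF assms(2)])
    show "?W s < p" if "s \<in> L_lattice 4" for s
      using that lt by (auto simp: L_lattice_def lattice_rect_3_3 grid_def)
    show "block_ok (tiles_of B) (curry ?W) x y"
      if "x = 0 \<or> x = 1" "y = 0 \<or> y = 1"
        "{(x, y), (x + 1, y), (x, y + 1), (x + 1, y + 1)} \<subseteq> L_lattice 4" for x y
      using that T by (elim disjE) (simp_all add: L_lattice_def lattice_rect_3_3 grid_def block_ok_def)
  qed blast
  from this(1)[of "(1, 0)"] this(1)[of "(1, 1)"] this(1)[of "(2, 1)"] this(2)[of 1 0]
  have "tiles_of B b (W' (2, 0)) e f"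
    by (simp add: L_lattice_def lattice_rect_3_3 grid_def block_ok_def)
  then show "\<exists>c. tiles_of B b c e f" ..
qed

lemma fillable_tiles_of:
  assumes B: "B \<subseteq> all_patterns p (lattice_rect 2 2)"
    and "locally_crisscross_extendable p B"
    and "card {i \<in> {1..4}. locally_corner_extendable p B i} \<ge> 3"
  shows "fillable (tiles_of B)"
proof -
  have "locally_corner_extendable p B i \<or> locally_corner_extendable p B j"
    if "i \<in> {1..4}" "j \<in> {1..4}" "i \<noteq> j" for i j
  proof (rule ccontr)
    assume "\<not> ?thesis"
    then have "{i \<in> {1..4}. locally_corner_extendable p B i} \<subseteq> {1..4} - {i, j}" by auto
    from card_mono[OF _ this] show False using that assms(3) by (simp add: card_Diff_subset)
  qed
  from this[of 1 2] this[of 1 3] this[of 1 4] this[of 2 3] this[of 2 4] this[of 3 4] show ?thesis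
    unfolding fillable_def
    using extendable_tiles_of[OF assms(2)] corner_ur_tiles_of[OF B] corner_ul_tiles_of[OF B]
      corner_ll_tiles_of[OF B] corner_lr_tiles_of[OF B] by auto
qed

section \<open>Entries of the transition matrices\<close>

lemma decode_psi:
  assumes "\<And>y. y \<in> {0..<int n} \<Longrightarrow> u y < p" "Suc i = psi p n (\<lambda>k. u (int k - 1))" "y \<in> {0..<int n}"
  shows "decode p n i y = u y"
proof -
  have "i = encode p n u" using assms(2) by (simp add: encode_def)
  then show ?thesis using decode_encode(2)[of n u p y] assms(1,3) by blast
qed

lemma psi_decode:
  assumes "i < p ^ n" "\<And>y. y \<in> {0..<int n} \<Longrightarrow> u y = decode p n i y"
  shows "Suc i = psi p n (\<lambda>k. u (int k - 1))"
proof -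
  have "encode p n u = i" using encode_decode[of i p n u] assms by blast
  then show ?thesis using Suc_encode[of p n u] by simp
qed

lemma decode_less: "p > 0 \<Longrightarrow> decode p n i y < p"
  by (simp add: decode_def)

lemma H_matrix_entry:
  assumes "p > 0" "i < p ^ n" "j < p ^ n"
  shows "(\<exists>U\<in>admissible_patterns p B (lattice_rect 2 n).
      Suc i = psi p n (\<lambda>k. U (0, int k - 1)) \<and> Suc j = psi p n (\<lambda>k. U (1, int k - 1))) \<longleftrightarrow>
    column_pair (tiles_of B) n (decode p n i) (decode p n j)" (is "?L \<longleftrightarrow> ?R")
proof
  assume ?L
  then obtain U where U: "U \<in> lattice_rect 2 n \<rightarrow>\<^sub>E {..<p}" "admissible B (lattice_rect 2 n) U"
    and ij: "Suc i = psi p n (\<lambda>k. U (0, int k - 1))" "Suc j = psi p n (\<lambda>k. U (1, int k - 1))"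
    unfolding admissible_patterns_def all_patterns_def by blast
  have lt: "U (x, y) < p" if "x \<in> {0, 1}" "y \<in> {0..<int n}" for x y
    using PiE_mem[OF U(1), of "(x, y)"] that by (auto simp: lattice_rect_eq)
  have eq: "decode p n i y = U (0, y) \<and> decode p n j y = U (1, y)" if "y \<in> {0..<int n}" for y
    using decode_psi[of n "\<lambda>y. U (0, y)", OF _ ij(1) that] decode_psi[of n "\<lambda>y. U (1, y)", OF _ ij(2) that] lt
    by simp
  have "column_pair (tiles_of B) n (\<lambda>y. U (0, y)) (\<lambda>y. U (1, y))"
    unfolding column_pair_def
  proof
    fix y assume "y \<in> {0..<int n - 1}"
    then have "block_ok (tiles_of B) (curry U) 0 y"
      using U(2) by (auto simp: admissible_iff lattice_rect_eq)
    then show "tiles_of B (U (0, y)) (U (1, y)) (U (0, y + 1)) (U (1, y + 1))"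
      by (simp add: block_ok_def)
  qed
  then show ?R
    using column_pair_cong[of n "decode p n i" "\<lambda>y. U (0, y)" "decode p n j" "\<lambda>y. U (1, y)"] eq
    by simp
next
  assume R: ?R
  define U where "U = restrict (\<lambda>(x, y). if x = 0 then decode p n i y else decode p n j y) (lattice_rect 2 n)"
  have U: "U (0, y) = decode p n i y" "U (1, y) = decode p n j y" if "y \<in> {0..<int n}" for y
    using that by (simp_all add: U_def lattice_rect_eq)
  have "U \<in> all_patterns p (lattice_rect 2 n)"
    using decode_less[OF assms(1)] by (auto simp: U_def all_patterns_def)
  moreover have "admissible B (lattice_rect 2 n) U"
    unfolding admissible_iff
  proof (intro allI impI)
    fix x y assume "{(x, y), (x + 1, y), (x, y + 1), (x + 1, y + 1)} \<subseteq> lattice_rect 2 n"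
    then have "x = 0" "y \<in> {0..<int n - 1}" "y \<in> {0..<int n}" "y + 1 \<in> {0..<int n}"
      by (auto simp: lattice_rect_eq)
    then show "block_ok (tiles_of B) (curry U) x y"
      using R by (simp add: block_ok_def U column_pair_def)
  qed
  moreover have "Suc i = psi p n (\<lambda>k. U (0, int k - 1))" "Suc j = psi p n (\<lambda>k. U (1, int k - 1))"
    using psi_decode[of i p n "\<lambda>y. U (0, y)"] psi_decode[of j p n "\<lambda>y. U (1, y)"] assms(2,3) U by simp_all
  ultimately show ?L unfolding admissible_patterns_def by blast
qed

text \<open>Swapping the axes turns the bottom and top rows into left and right columns, so
  \<open>V_matrix\<close> is the horizontal transition matrix of the swapped tiles.\<close>

lemma V_matrix_entry:
  assumes "p > 0" "i < p ^ n" "j < p ^ n"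
  shows "(\<exists>U\<in>admissible_patterns p B (lattice_rect n 2).
      Suc i = psi p n (\<lambda>k. U (int k - 1, 0)) \<and> Suc j = psi p n (\<lambda>k. U (int k - 1, 1))) \<longleftrightarrow>
    column_pair (swap_axes (tiles_of B)) n (decode p n i) (decode p n j)" (is "?L \<longleftrightarrow> ?R")
proof
  assume ?L
  then obtain U where U: "U \<in> lattice_rect n 2 \<rightarrow>\<^sub>E {..<p}" "admissible B (lattice_rect n 2) U"
    and ij: "Suc i = psi p n (\<lambda>k. U (int k - 1, 0))" "Suc j = psi p n (\<lambda>k. U (int k - 1, 1))"
    unfolding admissible_patterns_def all_patterns_def by blast
  have lt: "U (y, x) < p" if "x \<in> {0, 1}" "y \<in> {0..<int n}" for x y
    using PiE_mem[OF U(1), of "(y, x)"] that by (auto simp: lattice_rect_eq)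
  have eq: "decode p n i y = U (y, 0) \<and> decode p n j y = U (y, 1)" if "y \<in> {0..<int n}" for y
    using decode_psi[of n "\<lambda>y. U (y, 0)", OF _ ij(1) that] decode_psi[of n "\<lambda>y. U (y, 1)", OF _ ij(2) that] lt
    by simp
  have "column_pair (swap_axes (tiles_of B)) n (\<lambda>y. U (y, 0)) (\<lambda>y. U (y, 1))"
    unfolding column_pair_def
  proof
    fix y assume "y \<in> {0..<int n - 1}"
    then have "block_ok (tiles_of B) (curry U) y 0"
      using U(2) by (auto simp: admissible_iff lattice_rect_eq)
    then show "swap_axes (tiles_of B) (U (y, 0)) (U (y, 1)) (U (y + 1, 0)) (U (y + 1, 1))"
      by (simp add: block_ok_def swap_axes_def)
  qed
  then show ?R
    using column_pair_cong[of n "decode p n i" "\<lambda>y. U (y, 0)" "decode p n j" "\<lambda>y. U (y, 1)"] eq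
    by simp
next
  assume R: ?R
  define U where "U = restrict (\<lambda>(y, x). if x = 0 then decode p n i y else decode p n j y) (lattice_rect n 2)"
  have U: "U (y, 0) = decode p n i y" "U (y, 1) = decode p n j y" if "y \<in> {0..<int n}" for y
    using that by (simp_all add: U_def lattice_rect_eq)
  have "U \<in> all_patterns p (lattice_rect n 2)"
    using decode_less[OF assms(1)] by (auto simp: U_def all_patterns_def)
  moreover have "admissible B (lattice_rect n 2) U"
    unfolding admissible_iff
  proof (intro allI impI)
    fix y x assume "{(y, x), (y + 1, x), (y, x + 1), (y + 1, x + 1)} \<subseteq> lattice_rect n 2"
    then have "x = 0" "y \<in> {0..<int n - 1}" "y \<in> {0..<int n}" "y + 1 \<in> {0..<int n}"
      by (auto simp: lattice_rect_eq)
    then show "block_ok (tiles_of B) (curry U) y x"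
      using R by (simp add: block_ok_def U column_pair_def swap_axes_def)
  qed
  moreover have "Suc i = psi p n (\<lambda>k. U (int k - 1, 0))" "Suc j = psi p n (\<lambda>k. U (int k - 1, 1))"
    using psi_decode[of i p n "\<lambda>y. U (y, 0)"] psi_decode[of j p n "\<lambda>y. U (y, 1)"] assms(2,3) U by simp_all
  ultimately show ?L unfolding admissible_patterns_def by blast
qed

lemma weakly_primitive_H_iff:
  assumes "p > 0" "B \<subseteq> all_patterns p (lattice_rect 2 2)" "fillable (tiles_of B)" "n \<ge> 2"
  shows "weakly_primitive (H_matrix p B n) \<longleftrightarrow> eventually_joinable (tiles_of B) n"
proof -
  have "weakly_primitive (H_matrix p B n) \<longleftrightarrow> (\<exists>N\<ge>1. strip_joinable (tiles_of B) n N)"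
    unfolding H_matrix_def
    by (rule weakly_primitive_iff_strip_joinable[OF tiles_of_less[OF assms(2)] assms(4)
          H_matrix_entry[OF assms(1)]])
  then show ?thesis
    using eventually_joinable_if_strip_joinable strip_joinable_if_eventually_joinable assms(3,4) by blast
qed

lemma weakly_primitive_V_iff:
  assumes "p > 0" "B \<subseteq> all_patterns p (lattice_rect 2 2)" "fillable (tiles_of B)" "n \<ge> 2"
  shows "weakly_primitive (V_matrix p B n) \<longleftrightarrow> eventually_joinable (swap_axes (tiles_of B)) n"
proof -
  have less: "a < p \<and> b < p \<and> c < p \<and> d < p" if "swap_axes (tiles_of B) a b c d" for a b c d
    using tiles_of_less[OF assms(2)] that by (auto simp: swap_axes_def)
  have "weakly_primitive (V_matrix p B n) \<longleftrightarrow> (\<exists>N\<ge>1. strip_joinable (swap_axes (tiles_of B)) n N)"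
    unfolding V_matrix_def
    by (rule weakly_primitive_iff_strip_joinable[OF less assms(4) V_matrix_entry[OF assms(1)]])
  then show ?thesis
    using eventually_joinable_if_strip_joinable strip_joinable_if_eventually_joinable
      fillable_swap[OF assms(3)] assms(4) by blast
qed

section \<open>Mixing as joinability of windows\<close>

lemma admissible_patterns_UNIV_iff:
  assumes "B \<subseteq> all_patterns p (lattice_rect 2 2)"
  shows "U \<in> admissible_patterns p B UNIV \<longleftrightarrow> tiling (tiles_of B) (curry U)"
proof
  assume "U \<in> admissible_patterns p B UNIV"
  then show "tiling (tiles_of B) (curry U)"
    by (simp add: admissible_patterns_def admissible_iff tiling_def)
next
  assume T: "tiling (tiles_of B) (curry U)"
  have "U (x, y) < p" for x y
  proof -
    have "tiles_of B (U (x, y)) (U (x + 1, y)) (U (x, y + 1)) (U (x + 1, y + 1))"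
      using T by (simp add: tiling_def block_ok_def)
    from tiles_of_less[OF assms this] show ?thesis by blast
  qed
  then show "U \<in> admissible_patterns p B UNIV"
    using T by (auto simp: admissible_patterns_def all_patterns_def admissible_iff tiling_def)
qed

lemma joinable_if_topologically_mixing:
  assumes "B \<subseteq> all_patterns p (lattice_rect 2 2)"
    and mix: "topologically_mixing (admissible_patterns p B UNIV)"
  shows "\<exists>M. \<forall>a b. \<bar>a\<bar> \<ge> M \<or> \<bar>b\<bar> \<ge> M \<longrightarrow> joinable (tiles_of B) n a b"
\<comment> \<open>Empty windows are set aside: \<open>euclid_setdist\<close> is 0 for them, so the
  mixing constant might never be reached.\<close>
proof (cases "n = 0")
  case True
  then show ?thesis by (auto simp: joinable_def)
next
  case False
  let ?R = "lattice_rect n n" and ?\<Sigma> = "admissible_patterns p B UNIV"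
  have "finite ?R" by (simp add: lattice_rect_eq)
  then obtain M :: real where M: "\<And>v U1 U2. euclid_setdist ?R ((+) v ` ?R) \<ge> M \<Longrightarrow>
      U1 \<in> projection ?R ?\<Sigma> \<Longrightarrow> U2 \<in> projection ((+) v ` ?R) ?\<Sigma> \<Longrightarrow>
      \<exists>W\<in>?\<Sigma>. restrict W ?R = U1 \<and> restrict W ((+) v ` ?R) = U2"
    using mix unfolding topologically_mixing_def by meson
  \<comment> \<open>Coordinates within a window differ by less than \<open>n\<close>, so for any two
    sites of the two windows one coordinate still differs by at least
    \<open>\<lceil>M\<rceil>\<close>.\<close>
  define K where "K = \<lceil>M\<rceil> + int n"
  have "joinable (tiles_of B) n a b" if ab: "\<bar>a\<bar> \<ge> K \<or> \<bar>b\<bar> \<ge> K" for a b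
    unfolding joinable_def
  proof (intro allI impI)
    fix W1 W2 assume W: "tiling (tiles_of B) W1" "tiling (tiles_of B) W2"
    define X1 X2 where "X1 = (\<lambda>(x, y). W1 x y)" and "X2 = (\<lambda>(x, y). W2 x y)"
    have X: "X1 \<in> ?\<Sigma>" "X2 \<in> ?\<Sigma>"
      using W by (simp_all add: admissible_patterns_UNIV_iff[OF assms(1)] X1_def X2_def curry_def)
    have "euclid_setdist ?R ((+) (a, b) ` ?R) \<ge> M"
      unfolding euclid_setdist_def
    proof (rule le_setdistI)
      have "(0, 0) \<in> ?R" using False by (simp add: lattice_rect_eq)
      then show "map_prod real_of_int real_of_int ` ?R \<noteq> {}"
        "map_prod real_of_int real_of_int ` (+) (a, b) ` ?R \<noteq> {}" by blast+
      fix s t assume "s \<in> map_prod real_of_int real_of_int ` ?R"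
        "t \<in> map_prod real_of_int real_of_int ` (+) (a, b) ` ?R"
      then obtain x y z w where s: "s = (real_of_int x, real_of_int y)"
        and t: "t = (real_of_int (a + z), real_of_int (b + w))"
        and bounds: "x \<in> {0..<int n}" "y \<in> {0..<int n}" "z \<in> {0..<int n}" "w \<in> {0..<int n}"
        by (auto simp: lattice_rect_eq)
      have "\<bar>x - (a + z)\<bar> \<ge> \<lceil>M\<rceil> \<or> \<bar>y - (b + w)\<bar> \<ge> \<lceil>M\<rceil>"
        using ab bounds unfolding K_def by auto
      then have "M \<le> \<bar>real_of_int (x - (a + z))\<bar> \<or> M \<le> \<bar>real_of_int (y - (b + w))\<bar>"
        by (simp only: ceiling_le_iff of_int_abs[symmetric])
      moreover have "\<bar>real_of_int (x - (a + z))\<bar> \<le> dist s t" "\<bar>real_of_int (y - (b + w))\<bar> \<le> dist s t"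
        using dist_fst_le[of s t] dist_snd_le[of s t] by (simp_all add: s t dist_real_def)
      ultimately show "M \<le> dist s t" by linarith
    qed
    then obtain V where V: "V \<in> ?\<Sigma>" "restrict V ?R = restrict X1 ?R"
      "restrict V ((+) (a, b) ` ?R) = restrict X2 ((+) (a, b) ` ?R)"
      using M[of "(a, b)" "restrict X1 ?R" "restrict X2 ((+) (a, b) ` ?R)"] X
      unfolding projection_def by blast
    have "curry V x y = W1 x y \<and> curry V (x + a) (y + b) = W2 (x + a) (y + b)"
      if "x \<in> {0..<int n}" "y \<in> {0..<int n}" for x y
    proof -
      have "(x, y) \<in> ?R" using that by (simp add: lattice_rect_eq)
      moreover from this have "(x + a, y + b) \<in> (+) (a, b) ` ?R"
        by (auto simp: image_iff add.commute intro!: bexI[of _ "(x, y)"])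
      ultimately show ?thesis
        using fun_cong[OF V(2), of "(x, y)"] fun_cong[OF V(3), of "(x + a, y + b)"]
        by (simp add: X1_def X2_def)
    qed
    then show "\<exists>W. tiling (tiles_of B) W \<and> (\<forall>x\<in>{0..<int n}. \<forall>y\<in>{0..<int n}.
        W x y = W1 x y \<and> W (x + a) (y + b) = W2 (x + a) (y + b))"
      using V(1) admissible_patterns_UNIV_iff[OF assms(1)] by blast
  qed
  then show ?thesis by blast
qed

lemma finite_subset_square:
  fixes R :: "site set"
  assumes "finite R"
  obtains s where "R \<subseteq> {- int s..int s} \<times> {- int s..int s}"
proof -
  define s where "s = Max (insert 0 ((\<lambda>(x, y). nat \<bar>x\<bar> + nat \<bar>y\<bar>) ` R))"
  have "R \<subseteq> {- int s..int s} \<times> {- int s..int s}"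
  proof
    fix r assume "r \<in> R"
    obtain x y where r: "r = (x, y)" by force
    have "nat \<bar>x\<bar> + nat \<bar>y\<bar> \<le> s"
      unfolding s_def using assms \<open>r \<in> R\<close> r by (intro Max_ge) force+
    then show "r \<in> {- int s..int s} \<times> {- int s..int s}" by (auto simp: r)
  qed
  then show ?thesis using that by blast
qed

lemma topologically_mixing_if_joinable:
  assumes B: "B \<subseteq> all_patterns p (lattice_rect 2 2)"
    and far: "\<And>n. n \<ge> 2 \<Longrightarrow> \<exists>M. \<forall>a b. \<bar>a\<bar> \<ge> M \<or> \<bar>b\<bar> \<ge> M \<longrightarrow> joinable (tiles_of B) n a b"
  shows "topologically_mixing (admissible_patterns p B UNIV)"
  unfolding topologically_mixing_def
proof (intro allI impI)
  let ?\<Sigma> = "admissible_patterns p B UNIV"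
  fix R1 R2 :: "site set" assume "finite R1 \<and> finite R2"
  then obtain s where s: "R1 \<union> R2 \<subseteq> {- int s..int s} \<times> {- int s..int s}"
    using finite_subset_square[of "R1 \<union> R2"] by blast
  \<comment> \<open>The square from \<open>- s\<close> to \<open>s\<close> has side
    \<open>2 * s + 1\<close>; one more makes \<open>n \<ge> 2\<close> also for
    \<open>s = 0\<close>.\<close>
  define n where "n = 2 * s + 2"
  have "n \<ge> 2" by (simp add: n_def)
  then obtain M where M: "\<And>a b. \<bar>a\<bar> \<ge> M \<or> \<bar>b\<bar> \<ge> M \<Longrightarrow> joinable (tiles_of B) n a b"
    using far by blast
  \<comment> \<open>Sites of \<open>R1\<close> and of the displaced \<open>R2\<close> are at
    distance at most \<open>\<bar>a\<bar> + \<bar>b\<bar> + 4 * s\<close>, since each of the four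
    coordinates involved contributes up to \<open>s\<close>. So one of \<open>a\<close> and
    \<open>b\<close> reaches \<open>\<bar>M\<bar>\<close> in absolute value. Being positive,
    \<open>K\<close> also excludes empty sets, whose \<open>setdist\<close> is 0.\<close>
  define K where "K = 2 * \<bar>real_of_int M\<bar> + 4 * real s + 1"
  have "\<exists>W\<in>?\<Sigma>. restrict W R1 = U1 \<and> restrict W ((+) v ` R2) = U2"
    if dist: "euclid_setdist R1 ((+) v ` R2) \<ge> K"
      and U: "U1 \<in> projection R1 ?\<Sigma>" "U2 \<in> projection ((+) v ` R2) ?\<Sigma>" for v U1 U2
  proof -
    obtain a b where v: "v = (a, b)" by force
    have "euclid_setdist R1 ((+) v ` R2) > 0" using dist by (simp add: K_def)
    then have "R1 \<noteq> {}" "R2 \<noteq> {}" unfolding euclid_setdist_def by auto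
    then obtain x y z w where r: "(x, y) \<in> R1" "(z, w) \<in> R2" by fast
    then have "(x, y) \<in> {- int s..int s} \<times> {- int s..int s}" "(z, w) \<in> {- int s..int s} \<times> {- int s..int s}"
      using s by blast+
    then have bounds: "\<bar>x\<bar> \<le> int s" "\<bar>y\<bar> \<le> int s" "\<bar>z\<bar> \<le> int s" "\<bar>w\<bar> \<le> int s" by auto
    have "K \<le> dist (real_of_int x, real_of_int y) (real_of_int (a + z), real_of_int (b + w))"
      using dist unfolding euclid_setdist_def
      by (rule order_trans) (rule setdist_le_dist, use r v in force, use r v in force)
    also have "\<dots> \<le> \<bar>real_of_int x - real_of_int (a + z)\<bar> + \<bar>real_of_int y - real_of_int (b + w)\<bar>"
      unfolding dist_Pair_Pair dist_real_def by (rule sqrt_sum_squares_le_sum_abs[THEN order_trans]) simp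
    finally have "real_of_int (2 * \<bar>M\<bar> + 4 * int s + 1) \<le> real_of_int (\<bar>x - (a + z)\<bar> + \<bar>y - (b + w)\<bar>)"
      by (simp add: K_def)
    then have "2 * \<bar>M\<bar> + 4 * int s + 1 \<le> \<bar>x - (a + z)\<bar> + \<bar>y - (b + w)\<bar>"
      by (simp only: of_int_le_iff)
    then have "\<bar>a\<bar> \<ge> M \<or> \<bar>b\<bar> \<ge> M" using bounds by linarith
    then have join: "joinable (tiles_of B) n a b" by (rule M)
    obtain X1 X2 where X: "X1 \<in> ?\<Sigma>" "X2 \<in> ?\<Sigma>" "U1 = restrict X1 R1" "U2 = restrict X2 ((+) v ` R2)"
      using U unfolding projection_def by blast
    \<comment> \<open>The translation by \<open>s\<close> moves the square from \<open>- s\<close>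
      to \<open>s\<close> into the window at the origin.\<close>
    have X': "tiling (tiles_of B) (\<lambda>x y. curry X1 (x + - int s) (y + - int s))"
      "tiling (tiles_of B) (\<lambda>x y. curry X2 (x + - int s) (y + - int s))"
      using X(1,2) by (auto simp only: admissible_patterns_UNIV_iff[OF B] intro: tiling_shift)
    obtain W where W: "tiling (tiles_of B) W" "\<forall>x\<in>{0..<int n}. \<forall>y\<in>{0..<int n}.
        W x y = curry X1 (x + - int s) (y + - int s) \<and>
        W (x + a) (y + b) = curry X2 (x + a + - int s) (y + b + - int s)"
      using join[unfolded joinable_def, rule_format, OF X'] by blast
    define Y where "Y = (\<lambda>(x, y). W (x + int s) (y + int s))"
    have "Y \<in> ?\<Sigma>"
      using tiling_shift[OF W(1)] by (simp add: admissible_patterns_UNIV_iff[OF B] Y_def curry_def)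
    moreover have "restrict Y R1 = U1"
      unfolding X(3)
    proof (rule restrict_ext)
      fix r assume "r \<in> R1"
      obtain x y where r: "r = (x, y)" by force
      have "x + int s \<in> {0..<int n}" "y + int s \<in> {0..<int n}"
        using s \<open>r \<in> R1\<close> by (auto simp: r n_def)
      then show "Y r = X1 r" using W(2) by (simp add: r Y_def)
    qed
    moreover have "restrict Y ((+) v ` R2) = U2"
      unfolding X(4)
    proof (rule restrict_ext)
      fix r assume "r \<in> (+) v ` R2"
      then obtain x y where r: "r = (x + a, y + b)" "(x, y) \<in> R2" by (auto simp: v)
      have "x + int s \<in> {0..<int n}" "y + int s \<in> {0..<int n}"
        using s r(2) by (auto simp: n_def)
      then show "Y r = X2 r"
        using W(2)[rule_format, of "x + int s" "y + int s"] by (simp add: r(1) Y_def algebra_simps)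
    qed
    ultimately show ?thesis by (intro bexI[of _ Y] conjI)
  qed
  then show "\<exists>M. \<forall>v. euclid_setdist R1 ((+) v ` R2) \<ge> M \<longrightarrow>
      (\<forall>U1\<in>projection R1 ?\<Sigma>. \<forall>U2\<in>projection ((+) v ` R2) ?\<Sigma>.
        \<exists>W\<in>?\<Sigma>. restrict W R1 = U1 \<and> restrict W ((+) v ` R2) = U2)"
    by (intro exI[of _ K] allI impI ballI)
qed

theorem theorem1p1:
  fixes p :: nat and B :: "pattern set"
  assumes "p \<ge> 2"
    and "B \<subseteq> all_patterns p (lattice_rect 2 2)"
    and "locally_crisscross_extendable p B"
    and "card {i \<in> {1..4}. locally_corner_extendable p B i} \<ge> 3"
  shows "(\<forall>n \<ge> 2. weakly_primitive (H_matrix p B n) \<and> weakly_primitive (V_matrix p B n)) \<longleftrightarrow>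
         topologically_mixing (admissible_patterns p B UNIV)"
proof -
  let ?T = "tiles_of B"
  have fill: "fillable ?T" using fillable_tiles_of assms(2-4) by blast
  have p: "p > 0" using assms(1) by simp
  note H = weakly_primitive_H_iff[OF p assms(2) fill]
  note V = weakly_primitive_V_iff[OF p assms(2) fill]
  show ?thesis
  proof
    assume "\<forall>n\<ge>2. weakly_primitive (H_matrix p B n) \<and> weakly_primitive (V_matrix p B n)"
    then have "\<exists>M. \<forall>a b. \<bar>a\<bar> \<ge> M \<or> \<bar>b\<bar> \<ge> M \<longrightarrow> joinable ?T n a b" if "n \<ge> 2" for n
      using joinable_far[OF fill that] H V by simp
    then show "topologically_mixing (admissible_patterns p B UNIV)"
      by (rule topologically_mixing_if_joinable[OF assms(2)])
  next
    assume mix: "topologically_mixing (admissible_patterns p B UNIV)"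
    \<comment> \<open>Displacements along the axes suffice here; the vertical ones become horizontal
      when the axes are swapped.\<close>
    have "eventually_joinable ?T n \<and> eventually_joinable (swap_axes ?T) n" for n
    proof -
      obtain M where M: "\<And>a b. \<bar>a\<bar> \<ge> M \<or> \<bar>b\<bar> \<ge> M \<Longrightarrow> joinable ?T n a b"
        using joinable_if_topologically_mixing[OF assms(2) mix] by blast
      have "joinable ?T n a 0 \<and> joinable (swap_axes ?T) n a 0" if "a \<ge> M" for a
        using M[of a 0] joinable_swap[OF M[of 0 a]] that by force
      then show ?thesis unfolding eventually_joinable_def by blast
    qed
    then show "\<forall>n\<ge>2. weakly_primitive (H_matrix p B n) \<and> weakly_primitive (V_matrix p B n)"
      using H V by simp
  qed
qed

end
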